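(* There exists a distance-approximation algorithm for induced $P_3$-freeness whose query complexity is $\mathrm{poly}(1/\varepsilon)$.
   Context: Graphs are finite, simple and undirected; the input graph $G=(V,E)$ has $n=|V|$ vertices. The distance between two graphs $G=(V,E)$ and $G'=(V,E')$ on the same vertex set is $\Delta(G,G')=(|E\setminus E'|+|E'\setminus E|)/n^2$, and for a graph property $\mathcal{P}$ (a set of graphs), $\Delta(G,\mathcal{P})$ is the minimum of $\Delta(G,G')$ over $G'\in\mathcal{P}$ on the same vertex set. A distance-approximation algorithm for $\mathcal{P}$ is a randomized algorithm that, for every graph $G$ and every $\varepsilon\in(0,1)$, given $\varepsilon$ and query access to the adjacency matrix of $G$ (queries of the form "is $(u,v)\in E$?"), outputs an estimate $\hat\Delta$ with $|\hat\Delta-\Delta(G,\mathcal{P})|\le\varepsilon$ with probability at least $2/3$; its query complexity is the number of such queries (here bounded as a function of $\varepsilon$ only). $P_3$ is the path on $3$ vertices; a graph is induced $P_3$-free if no induced subgraph of it is isomorphic to $P_3$. *)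

theory Defs
  imports "HOL-Probability.Probability" "HOL-Computational_Algebra.Polynomial"
begin

section \<open>Finite simple graphs\<close>

text \<open>A graph is a pair of a vertex set and a set of edges, each edge being a two-element set.\<close>

type_synonym 'a graph = "'a set \<times> 'a set set"

abbreviation verts :: "'a graph \<Rightarrow> 'a set" where "verts \<equiv> fst"
abbreviation edges :: "'a graph \<Rightarrow> 'a set set" where "edges \<equiv> snd"

definition simple_graph :: "'a graph \<Rightarrow> bool" where
  "simple_graph G \<longleftrightarrow> finite (verts G) \<and> (\<forall>e\<in>edges G. e \<subseteq> verts G \<and> card e = 2)"

definition adjacent :: "'a graph \<Rightarrow> 'a \<Rightarrow> 'a \<Rightarrow> bool" where
  "adjacent G u v \<longleftrightarrow> {u, v} \<in> edges G"

definition induced_subgraph :: "'a graph \<Rightarrow> 'a set \<Rightarrow> 'a graph" where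
  "induced_subgraph G S = (S, {e \<in> edges G. e \<subseteq> S})"

definition graph_isomorphic :: "'a graph \<Rightarrow> 'b graph \<Rightarrow> bool" where
  "graph_isomorphic G H \<longleftrightarrow>
     (\<exists>f. bij_betw f (verts G) (verts H) \<and>
          (\<forall>u\<in>verts G. \<forall>v\<in>verts G. adjacent G u v \<longleftrightarrow> adjacent H (f u) (f v)))"

definition P3 :: "nat graph" where
  "P3 = ({0, 1, 2}, {{0, 1}, {1, 2}})"

definition induced_free :: "'b graph \<Rightarrow> 'a graph set" where
  "induced_free H =
     {G. simple_graph G \<and> (\<forall>S\<subseteq>verts G. \<not> graph_isomorphic (induced_subgraph G S) H)}"


section \<open>Distance to a graph property\<close>

definition graph_dist :: "'a graph \<Rightarrow> 'a graph \<Rightarrow> real" where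
  "graph_dist G G' =
     real (card (edges G - edges G') + card (edges G' - edges G)) / real (card (verts G)) ^ 2"

text \<open>The set below is finite when \<open>G\<close> and the members of \<open>\<P>\<close> are simple graphs, so
  \<open>Min\<close> is the minimum as soon as \<open>\<P>\<close> contains a graph on the vertex set of \<open>G\<close>; for
  \<open>induced_free P3\<close> the edgeless graph is always such a graph.\<close>

definition dist_to_property :: "'a graph \<Rightarrow> 'a graph set \<Rightarrow> real" where
  "dist_to_property G \<P> = Min {graph_dist G G' | G'. G' \<in> \<P> \<and> verts G' = verts G}"


section \<open>Randomized query algorithms\<close>

text \<open>A deterministic adaptive query algorithm is a decision tree: \<open>Query u v t f\<close> asks whether
  \<open>(u, v)\<close> is an edge and continues with \<open>t\<close> if it is and with \<open>f\<close> otherwise. The vertices of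
  an input graph are labelled by an initial segment of the natural numbers, and a query at a label
  outside the graph is answered negatively.\<close>

datatype query_tree = Output real | Query nat nat query_tree query_tree

primrec run :: "query_tree \<Rightarrow> nat graph \<Rightarrow> real" where
  "run (Output r) G = r"
| "run (Query u v t f) G = (if adjacent G u v then run t G else run f G)"

primrec num_queries :: "query_tree \<Rightarrow> nat graph \<Rightarrow> nat" where
  "num_queries (Output r) G = 0"
| "num_queries (Query u v t f) G =
     Suc (if adjacent G u v then num_queries t G else num_queries f G)"

text \<open>A randomized algorithm draws its decision tree at random. It knows the number \<open>n\<close> of
  vertices (the dimension of the adjacency matrix) and the accuracy \<open>\<epsilon>\<close>. As usual for query
  complexity, its internal computation is not restricted.\<close>

type_synonym randomized_algorithm = "nat \<Rightarrow> real \<Rightarrow> query_tree pmf"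

definition distance_approximation :: "randomized_algorithm \<Rightarrow> nat graph set \<Rightarrow> bool" where
  "distance_approximation A \<P> \<longleftrightarrow>
     (\<forall>n \<epsilon> G. 0 < \<epsilon> \<and> \<epsilon> < 1 \<and> simple_graph G \<and> verts G = {..<n} \<longrightarrow>
        measure_pmf.prob (A n \<epsilon>) {T. \<bar>run T G - dist_to_property G \<P>\<bar> \<le> \<epsilon>} \<ge> 2 / 3)"

text \<open>The bound \<open>q\<close> depends on \<open>\<epsilon>\<close> only and holds for every input graph and every outcome of the
  random choices.\<close>

definition query_complexity_le :: "randomized_algorithm \<Rightarrow> (real \<Rightarrow> real) \<Rightarrow> bool" where
  "query_complexity_le A q \<longleftrightarrow>
     (\<forall>n \<epsilon> G. 0 < \<epsilon> \<and> \<epsilon> < 1 \<and> simple_graph G \<and> verts G = {..<n} \<longrightarrow>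
        (\<forall>T\<in>set_pmf (A n \<epsilon>). real (num_queries T G) \<le> q \<epsilon>))"

end

theory Submission
  imports Defs "HOL-Real_Asymp.Real_Asymp"
begin

text \<open>A graph is induced \<open>P\<^sub>3\<close>-free iff it is a disjoint union of cliques, so the distance is a
  correlation-clustering cost, and merging clusters at random shows that \<open>k = O(1/\<epsilon>)\<close> clusters suffice up
  to an additive error \<open>1/(2k)\<close>. Relax to label distributions \<open>x v\<close>; the cost is multilinear, so rounding
  loses nothing. The minimiser of the cost plus a small entropy term satisfies
  \<open>x v i \<propto> exp (- pull x v i / \<lambda>)\<close>, where \<open>pull x v i\<close> is an average over all vertices \<open>u\<close>. It is
  therefore determined up to a small error by a sample of \<open>poly(1/\<epsilon>)\<close> vertices together with labels
  drawn from \<open>x\<close>. The algorithm tries all labellings of the sample, which gives candidates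
  that can be evaluated at any vertex with few queries, estimates the cost of every candidate on
  random vertex pairs, and outputs the minimum. The number of candidates is exponential in
  \<open>poly(1/\<epsilon>)\<close>, so a union bound costs only \<open>poly(1/\<epsilon>)\<close> test pairs.\<close>

section \<open>Fractional clusterings\<close>

definition label_dist :: "nat \<Rightarrow> (nat \<Rightarrow> real) set" where
  "label_dist k = {p. (\<forall>i. 0 \<le> p i) \<and> (\<forall>i\<ge>k. p i = 0) \<and> (\<Sum>i<k. p i) = 1}"

definition one_hot :: "nat \<Rightarrow> nat \<Rightarrow> real" where
  "one_hot l i = of_bool (i = l)"

definition agree :: "nat \<Rightarrow> (nat \<Rightarrow> real) \<Rightarrow> (nat \<Rightarrow> real) \<Rightarrow> real" where
  "agree k p q = (\<Sum>i<k. p i * q i)"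

text \<open>This is the probability that the pair is misclustered when the labels of
  \<open>u\<close> and \<open>v\<close> are drawn independently from \<open>x u\<close> and
  \<open>x v\<close>. For one-hot \<open>x\<close> it is a plain disagreement indicator.\<close>

definition pair_cost ::
    "('a \<Rightarrow> 'a \<Rightarrow> bool) \<Rightarrow> nat \<Rightarrow> ('a \<Rightarrow> nat \<Rightarrow> real) \<Rightarrow> 'a \<Rightarrow> 'a \<Rightarrow> real" where
  "pair_cost E k x u v =
     (if u = v then 0 else if E u v then 1 - agree k (x u) (x v) else agree k (x u) (x v))"

definition total_cost ::
    "'a set \<Rightarrow> ('a \<Rightarrow> 'a \<Rightarrow> bool) \<Rightarrow> nat \<Rightarrow> ('a \<Rightarrow> nat \<Rightarrow> real) \<Rightarrow> real" where
  "total_cost V E k x = (\<Sum>u\<in>V. \<Sum>v\<in>V. pair_cost E k x u v)"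

definition disagreements :: "'a set \<Rightarrow> ('a \<Rightarrow> 'a \<Rightarrow> bool) \<Rightarrow> ('a \<Rightarrow> nat) \<Rightarrow> real" where
  "disagreements V E \<phi> = (\<Sum>u\<in>V. \<Sum>v\<in>V. of_bool (u \<noteq> v \<and> E u v \<noteq> (\<phi> u = \<phi> v)))"

definition edge_sign :: "('a \<Rightarrow> 'a \<Rightarrow> bool) \<Rightarrow> 'a \<Rightarrow> 'a \<Rightarrow> real" where
  "edge_sign E u v = (if u = v then 0 else if E u v then -1 else 1)"

text \<open>Up to a factor 2 this is the partial derivative of \<open>total_cost\<close> in the
  coordinate \<open>x v i\<close>. Since \<open>edge_sign\<close> vanishes on the diagonal, it does
  not involve \<open>x v\<close> itself.\<close>

definition pull ::
    "'a set \<Rightarrow> ('a \<Rightarrow> 'a \<Rightarrow> bool) \<Rightarrow> ('a \<Rightarrow> nat \<Rightarrow> real) \<Rightarrow> 'a \<Rightarrow> nat \<Rightarrow> real" where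
  "pull V E x v i = (\<Sum>u\<in>V. edge_sign E u v * x u i)"

lemma label_dist_nonneg: "p \<in> label_dist k \<Longrightarrow> 0 \<le> p i"
  and label_dist_sum: "p \<in> label_dist k \<Longrightarrow> (\<Sum>i<k. p i) = 1"
  and label_dist_zero: "p \<in> label_dist k \<Longrightarrow> k \<le> i \<Longrightarrow> p i = 0"
  by (auto simp: label_dist_def)

lemma label_dist_le_1:
  assumes "p \<in> label_dist k"
  shows "p i \<le> 1"
proof (cases "i < k")
  case True
  then have "p i \<le> (\<Sum>i<k. p i)"
    using label_dist_nonneg[OF assms] by (intro member_le_sum) auto
  then show ?thesis using label_dist_sum[OF assms] by simp
qed (use label_dist_zero[OF assms, of i] in simp)

lemma one_hot_label_dist: "l < k \<Longrightarrow> one_hot l \<in> label_dist k"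
  by (auto simp: label_dist_def one_hot_def of_bool_def)

lemma agree_one_hot: "l < k \<Longrightarrow> agree k (one_hot l) (one_hot m) = of_bool (l = m)"
  by (auto simp: agree_def one_hot_def of_bool_def if_distrib[of "\<lambda>x. x * _"] cong: if_cong)

lemma agree_commute: "agree k p q = agree k q p"
  by (simp add: agree_def mult.commute)

lemma agree_bounds:
  assumes "p \<in> label_dist k" "q \<in> label_dist k"
  shows "0 \<le> agree k p q" "agree k p q \<le> 1"
proof -
  show "0 \<le> agree k p q"
    unfolding agree_def using assms by (intro sum_nonneg mult_nonneg_nonneg label_dist_nonneg)
  have "agree k p q \<le> (\<Sum>i<k. p i * 1)"
    unfolding agree_def using assms
    by (intro sum_mono mult_left_mono label_dist_le_1 label_dist_nonneg)
  then show "agree k p q \<le> 1" using label_dist_sum[OF assms(1)] by simp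
qed

lemma pair_cost_bounds:
  assumes "\<And>v. x v \<in> label_dist k"
  shows "0 \<le> pair_cost E k x u v" "pair_cost E k x u v \<le> 1"
  using agree_bounds[OF assms assms, of u v] by (auto simp: pair_cost_def)

lemma total_cost_one_hot:
  assumes "\<And>v. \<phi> v < k"
  shows "total_cost V E k (\<lambda>v. one_hot (\<phi> v)) = disagreements V E \<phi>"
  unfolding total_cost_def disagreements_def pair_cost_def
  by (intro sum.cong refl) (auto simp: agree_one_hot assms)

lemma pair_cost_sym:
  assumes "symp E"
  shows "pair_cost E k x u v = pair_cost E k x v u"
  using assms by (auto simp: pair_cost_def agree_commute symp_def)

lemma pair_cost_eq_sign:
  "pair_cost E k x u v = of_bool (u \<noteq> v \<and> E u v) + edge_sign E u v * agree k (x u) (x v)"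
  by (simp add: pair_cost_def edge_sign_def)

section \<open>Multilinearity of the cost and rounding\<close>

lemma total_cost_split:
  assumes "finite V" "v \<in> V" "symp E"
  shows "total_cost V E k x =
    (\<Sum>u\<in>V-{v}. \<Sum>w\<in>V-{v}. pair_cost E k x u w) + 2 * (\<Sum>u\<in>V-{v}. pair_cost E k x u v)"
proof -
  have *: "(\<Sum>w\<in>V. pair_cost E k x u w) = pair_cost E k x u v + (\<Sum>w\<in>V-{v}. pair_cost E k x u w)" for u
    by (rule sum.remove[OF assms(1,2)])
  have "total_cost V E k x = (\<Sum>w\<in>V. pair_cost E k x v w) + (\<Sum>u\<in>V-{v}. \<Sum>w\<in>V. pair_cost E k x u w)"
    unfolding total_cost_def by (rule sum.remove[OF assms(1,2)])
  also have "(\<Sum>w\<in>V. pair_cost E k x v w) = (\<Sum>u\<in>V-{v}. pair_cost E k x u v)"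
    unfolding *[of v] by (simp add: pair_cost_def[of _ _ _ v v] pair_cost_sym[OF assms(3), of _ _ v])
  also have "(\<Sum>u\<in>V-{v}. \<Sum>w\<in>V. pair_cost E k x u w) =
      (\<Sum>u\<in>V-{v}. pair_cost E k x u v) + (\<Sum>u\<in>V-{v}. \<Sum>w\<in>V-{v}. pair_cost E k x u w)"
    unfolding sum.distrib[symmetric] by (rule sum.cong[OF refl *])
  finally show ?thesis by simp
qed

text \<open>No pair contains \<open>v\<close> twice at positive cost, so the cost is affine in the
  vector \<open>x v\<close> with slope given by \<open>pull\<close>. The factor 2 arises because
  ordered pairs are summed and \<open>E\<close> is symmetric.\<close>

lemma total_cost_update:
  assumes "finite V" "v \<in> V" "symp E"
  shows "total_cost V E k (x(v := p)) =
    total_cost V E k (x(v := q)) + 2 * (\<Sum>i<k. (p i - q i) * pull V E x v i)"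
proof -
  have 1: "(\<Sum>u\<in>V-{v}. \<Sum>w\<in>V-{v}. pair_cost E k (x(v := r)) u w) =
      (\<Sum>u\<in>V-{v}. \<Sum>w\<in>V-{v}. pair_cost E k x u w)" for r
    by (intro sum.cong refl) (auto simp: pair_cost_def)
  have pull: "pull V E x v i = (\<Sum>u\<in>V-{v}. edge_sign E u v * x u i)" for i
    unfolding pull_def using assms by (simp add: sum.remove edge_sign_def[of _ v v])
  have 2: "(\<Sum>u\<in>V-{v}. pair_cost E k (x(v := r)) u v) =
      (\<Sum>u\<in>V-{v}. of_bool (u \<noteq> v \<and> E u v)) + (\<Sum>i<k. r i * pull V E x v i)" for r
  proof -
    have "(\<Sum>u\<in>V-{v}. pair_cost E k (x(v := r)) u v) =
      (\<Sum>u\<in>V-{v}. of_bool (u \<noteq> v \<and> E u v) + (\<Sum>i<k. r i * (edge_sign E u v * x u i)))"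
      by (intro sum.cong refl) (auto simp: pair_cost_eq_sign agree_def sum_distrib_left mult_ac)
    also have "\<dots> = (\<Sum>u\<in>V-{v}. of_bool (u \<noteq> v \<and> E u v)) + (\<Sum>i<k. r i * pull V E x v i)"
      unfolding sum.distrib pull sum_distrib_left by (subst (2) sum.swap) simp
    finally show ?thesis .
  qed
  show ?thesis
    unfolding total_cost_split[OF assms] 1 2
    by (simp add: left_diff_distrib sum_subtractf)
qed

lemma exists_le_average:
  fixes g p :: "nat \<Rightarrow> real"
  assumes "p \<in> label_dist k"
  shows "\<exists>i<k. g i \<le> (\<Sum>i<k. p i * g i)"
proof (rule ccontr)
  assume "\<not> ?thesis"
  then have less: "\<And>i. i < k \<Longrightarrow> (\<Sum>i<k. p i * g i) < g i" by force
  define m where "m = (\<Sum>i<k. p i * g i)"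
  have "(\<Sum>i<k. p i * (g i - m)) = 0"
    using label_dist_sum[OF assms]
    by (simp add: right_diff_distrib sum_subtractf flip: sum_distrib_right) (simp add: m_def)
  moreover have "\<forall>i\<in>{..<k}. 0 \<le> p i * (g i - m)"
    by (auto simp: m_def less_imp_le[OF less] label_dist_nonneg[OF assms])
  ultimately have "\<forall>i\<in>{..<k}. p i * (g i - m) = 0"
    by (subst (asm) sum_nonneg_eq_0_iff) auto
  then have "\<forall>i\<in>{..<k}. p i = 0" using less by (fastforce simp: m_def)
  then show False using label_dist_sum[OF assms] by simp
qed

text \<open>Method of conditional expectations: with the other vertices frozen the cost is affine in
  \<open>x v\<close>, so some vertex of the simplex does at least as well as \<open>x v\<close>.
  Vertices of \<open>V\<close> are rounded one after the other; \<open>W\<close> is the set already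
  treated.\<close>

lemma rounding:
  assumes "finite V" "symp E" "\<And>v. x v \<in> label_dist k"
  shows "\<exists>\<phi>. disagreements V E \<phi> \<le> total_cost V E k x"
proof -
  have "k > 0" using label_dist_sum[OF assms(3)] by (cases k) auto
  have "\<exists>y. (\<forall>v. y v \<in> label_dist k) \<and> (\<forall>v\<in>W. \<exists>l<k. y v = one_hot l) \<and>
          total_cost V E k y \<le> total_cost V E k x" if "finite W" "W \<subseteq> V" for W
    using that
  proof (induction W rule: finite_induct)
    case empty
    show ?case using assms(3) by auto
  next
    case (insert v W)
    then obtain y where y: "\<forall>v. y v \<in> label_dist k" "\<forall>v\<in>W. \<exists>l<k. y v = one_hot l"
      "total_cost V E k y \<le> total_cost V E k x" by auto
    obtain l where l: "l < k" "pull V E y v l \<le> (\<Sum>i<k. y v i * pull V E y v i)"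
      using exists_le_average[of "y v" k "pull V E y v"] y(1) by blast
    have "(\<Sum>i<k. one_hot l i * pull V E y v i) = pull V E y v l"
      using l(1) by (simp add: one_hot_def of_bool_def if_distrib[of "\<lambda>x. x * _"] cong: if_cong)
    then have "total_cost V E k (y(v := one_hot l)) \<le> total_cost V E k y"
      using total_cost_update[OF assms(1) _ assms(2), of v k y "one_hot l" "y v"] insert.prems l
      by (simp add: left_diff_distrib sum_subtractf)
    with y(3) have "total_cost V E k (y(v := one_hot l)) \<le> total_cost V E k x" by linarith
    moreover have "\<forall>u. (y(v := one_hot l)) u \<in> label_dist k"
      using y(1) one_hot_label_dist[OF l(1)] by simp
    moreover have "\<forall>u\<in>insert v W. \<exists>l'<k. (y(v := one_hot l)) u = one_hot l'"
      using y(2) l(1) by auto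
    ultimately show ?case by blast
  qed
  from this[OF assms(1)] obtain y where y: "\<And>v. v \<in> V \<Longrightarrow> \<exists>l<k. y v = one_hot l"
    "total_cost V E k y \<le> total_cost V E k x" by blast
  obtain \<phi> where \<phi>: "\<And>v. v \<in> V \<Longrightarrow> \<phi> v < k \<and> y v = one_hot (\<phi> v)"
    using y(1) by metis
  \<comment> \<open>\<open>total_cost_one_hot\<close> wants labels below \<open>k\<close>
    everywhere, so the label 0 is put outside \<open>V\<close>, where the cost does not
    look.\<close>
  have "disagreements V E \<phi> = disagreements V E (\<lambda>v. if v \<in> V then \<phi> v else 0)"
    unfolding disagreements_def by (intro sum.cong) auto
  also have "\<dots> = total_cost V E k (\<lambda>v. one_hot (if v \<in> V then \<phi> v else 0))"
    by (rule total_cost_one_hot[symmetric]) (use \<phi> \<open>k > 0\<close> in auto)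
  also have "\<dots> = total_cost V E k y"
    unfolding total_cost_def pair_cost_def by (intro sum.cong) (auto simp: \<phi>)
  finally show ?thesis using y(2) by (intro exI[of _ \<phi>]) simp
qed

section \<open>Few clusters suffice\<close>

text \<open>Under a uniformly random map into \<open>k\<close> bins two distinct elements collide
  with probability \<open>1/k\<close>. The induction derandomises this: each new element goes to a
  bin whose collision weight with the elements already placed is at most the average over all
  bins.\<close>

lemma exists_hash:
  fixes w :: "'c \<Rightarrow> 'c \<Rightarrow> real"
  assumes "finite C" "k > 0"
  shows "\<exists>h. (\<forall>a. h a < k) \<and>
    real k * (\<Sum>a\<in>C. \<Sum>b\<in>C-{a}. of_bool (h a = h b) * w a b) \<le> (\<Sum>a\<in>C. \<Sum>b\<in>C-{a}. w a b)"
  using assms(1)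
proof (induction C rule: finite_induct)
  case empty
  show ?case using \<open>k > 0\<close> by auto
next
  case (insert c C)
  then obtain h where h: "\<forall>a. h a < k"
    "real k * (\<Sum>a\<in>C. \<Sum>b\<in>C-{a}. of_bool (h a = h b) * w a b) \<le> (\<Sum>a\<in>C. \<Sum>b\<in>C-{a}. w a b)"
    by auto
  have split: "(\<Sum>a\<in>insert c C. \<Sum>b\<in>insert c C-{a}. f a b) =
      (\<Sum>a\<in>C. \<Sum>b\<in>C-{a}. f a b) + (\<Sum>a\<in>C. f a c + f c a)" for f :: "'c \<Rightarrow> 'c \<Rightarrow> real"
  proof -
    have 1: "(\<Sum>b\<in>insert c C-{a}. f a b) = f a c + (\<Sum>b\<in>C-{a}. f a b)" if "a \<in> C" for a
    proof -
      have eq: "insert c C - {a} = insert c (C - {a})" using that insert.hyps by auto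
      show ?thesis unfolding eq by (rule sum.insert) (use insert.hyps in auto)
    qed
    have 2: "insert c C - {c} = C" using insert.hyps by auto
    have "(\<Sum>a\<in>insert c C. \<Sum>b\<in>insert c C-{a}. f a b) =
        (\<Sum>b\<in>insert c C-{c}. f c b) + (\<Sum>a\<in>C. \<Sum>b\<in>insert c C-{a}. f a b)"
      by (rule sum.insert) (use insert.hyps in auto)
    also have "\<dots> = (\<Sum>b\<in>C. f c b) + (\<Sum>a\<in>C. f a c + (\<Sum>b\<in>C-{a}. f a b))"
      unfolding 2 by (simp only: 1 cong: sum.cong)
    finally show ?thesis by (simp only: sum.distrib add_ac)
  qed
  define g where "g i = (\<Sum>a\<in>C. of_bool (h a = i) * (w a c + w c a))" for i
  have "(\<Sum>i<k. g i) = (\<Sum>a\<in>C. \<Sum>i<k. of_bool (h a = i) * (w a c + w c a))"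
    unfolding g_def by (rule sum.swap)
  also have "\<dots> = (\<Sum>a\<in>C. w a c + w c a)"
    using h(1) by (intro sum.cong refl) (simp flip: sum_distrib_right)
  finally have sum_g: "(\<Sum>i<k. g i) = (\<Sum>a\<in>C. w a c + w c a)" .
  define p where "p i = (if i < k then 1 / real k else 0)" for i
  have "p \<in> label_dist k"
    using \<open>k > 0\<close> by (auto simp: label_dist_def p_def)
  from exists_le_average[OF this, of g] obtain i where i: "i < k" "g i \<le> (\<Sum>i<k. p i * g i)"
    by blast
  have "real k * (\<Sum>i<k. p i * g i) = (\<Sum>i<k. g i)"
    unfolding sum_distrib_left using \<open>k > 0\<close> by (intro sum.cong refl) (simp add: p_def)
  with i(2) \<open>k > 0\<close> have gi: "real k * g i \<le> (\<Sum>i<k. g i)"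
    by (metis mult_left_mono of_nat_0_le_iff)
  define h' where "h' = h(c := i)"
  have h'_C: "h' a = h a" if "a \<in> C" for a using that insert.hyps by (auto simp: h'_def)
  have h'_c: "h' c = i" by (simp add: h'_def)
  have "(\<Sum>a\<in>insert c C. \<Sum>b\<in>insert c C-{a}. of_bool (h' a = h' b) * w a b) =
      (\<Sum>a\<in>C. \<Sum>b\<in>C-{a}. of_bool (h' a = h' b) * w a b) +
      (\<Sum>a\<in>C. of_bool (h' a = h' c) * w a c + of_bool (h' c = h' a) * w c a)"
    by (rule split[of "\<lambda>a b. of_bool (h' a = h' b) * w a b"])
  also have "(\<Sum>a\<in>C. \<Sum>b\<in>C-{a}. of_bool (h' a = h' b) * w a b) =
      (\<Sum>a\<in>C. \<Sum>b\<in>C-{a}. of_bool (h a = h b) * w a b)"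
    by (intro sum.cong refl) (simp add: h'_C)
  also have "(\<Sum>a\<in>C. of_bool (h' a = h' c) * w a c + of_bool (h' c = h' a) * w c a) = g i"
    unfolding g_def by (intro sum.cong refl) (simp add: h'_C h'_c distrib_left eq_commute[of i])
  finally have "real k * (\<Sum>a\<in>insert c C. \<Sum>b\<in>insert c C-{a}. of_bool (h' a = h' b) * w a b)
      \<le> (\<Sum>a\<in>insert c C. \<Sum>b\<in>insert c C-{a}. w a b)"
    using add_mono[OF h(2) gi] by (simp only: split[of w] sum_g distrib_left)
  moreover have "\<forall>a. h' a < k" using h(1) i(1) by (simp add: h'_def)
  ultimately show ?case by blast
qed

lemma sum_swap2:
  "(\<Sum>a\<in>A. \<Sum>b\<in>B. \<Sum>u\<in>C. \<Sum>v\<in>D. f a b u v) = (\<Sum>u\<in>C. \<Sum>v\<in>D. \<Sum>a\<in>A. \<Sum>b\<in>B. f a b u v)"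
proof -
  have "(\<Sum>p\<in>A\<times>B. \<Sum>q\<in>C\<times>D. f (fst p) (snd p) (fst q) (snd q)) =
      (\<Sum>q\<in>C\<times>D. \<Sum>p\<in>A\<times>B. f (fst p) (snd p) (fst q) (snd q))"
    by (rule sum.swap)
  then show ?thesis by (simp only: sum.cartesian_product' fst_conv snd_conv)
qed

text \<open>Composing \<open>\<phi>\<close> with a hash of its labels into \<open>k\<close> bins
  only merges clusters, so a new disagreement needs two vertices of different clusters whose labels
  collide. A good hash leaves at most a \<open>1/k\<close> fraction of the ordered pairs in this
  position.\<close>

lemma few_clusters:
  assumes "finite V" "k > 0"
  shows "\<exists>\<psi>. (\<forall>v. \<psi> v < k) \<and>
    disagreements V E \<psi> \<le> disagreements V E \<phi> + real (card V) ^ 2 / real k"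
proof -
  define C where "C = \<phi> ` V"
  have fC: "finite C" using assms by (simp add: C_def)
  \<comment> \<open>The weight of two clusters is the number of ordered vertex pairs between them,
    that is, the price of merging them in the worst case. The fact \<open>swap\<close> passes from
    sums over cluster pairs to sums over vertex pairs.\<close>
  define w :: "nat \<Rightarrow> nat \<Rightarrow> real"
    where "w a b = (\<Sum>u\<in>V. \<Sum>v\<in>V. of_bool (\<phi> u = a \<and> \<phi> v = b))" for a b
  have swap: "(\<Sum>a\<in>C. \<Sum>b\<in>C-{a}. f a b * w a b) = (\<Sum>u\<in>V. \<Sum>v\<in>V. of_bool (\<phi> u \<noteq> \<phi> v) * f (\<phi> u) (\<phi> v))"
    for f :: "nat \<Rightarrow> nat \<Rightarrow> real"
  proof -
    have "(\<Sum>a\<in>C. \<Sum>b\<in>C-{a}. f a b * w a b) =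
      (\<Sum>a\<in>C. \<Sum>b\<in>C. \<Sum>u\<in>V. \<Sum>v\<in>V. of_bool (a \<noteq> b) * f a b * of_bool (\<phi> u = a \<and> \<phi> v = b))"
    proof (rule sum.cong[OF refl])
      fix a assume "a \<in> C"
      have "(\<Sum>b\<in>C-{a}. f a b * w a b) = (\<Sum>b\<in>C. of_bool (a \<noteq> b) * f a b * w a b)"
        by (rule sum.mono_neutral_cong_left) (use fC in auto)
      then show "(\<Sum>b\<in>C-{a}. f a b * w a b) =
          (\<Sum>b\<in>C. \<Sum>u\<in>V. \<Sum>v\<in>V. of_bool (a \<noteq> b) * f a b * of_bool (\<phi> u = a \<and> \<phi> v = b))"
        by (simp add: w_def sum_distrib_left)
    qed
    also have "\<dots> = (\<Sum>u\<in>V. \<Sum>v\<in>V. \<Sum>a\<in>C. \<Sum>b\<in>C. of_bool (a \<noteq> b) * f a b * of_bool (\<phi> u = a \<and> \<phi> v = b))"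
      by (rule sum_swap2[of "\<lambda>a b u v. of_bool (a \<noteq> b) * f a b * of_bool (\<phi> u = a \<and> \<phi> v = b)"])
    also have "\<dots> = (\<Sum>u\<in>V. \<Sum>v\<in>V. of_bool (\<phi> u \<noteq> \<phi> v) * f (\<phi> u) (\<phi> v))"
    proof (intro sum.cong refl)
      fix u v assume uv: "u \<in> V" "v \<in> V"
      have C: "\<phi> u \<in> C" "\<phi> v \<in> C" using uv by (auto simp: C_def)
      have "(\<Sum>a\<in>C. \<Sum>b\<in>C. of_bool (a \<noteq> b) * f a b * of_bool (\<phi> u = a \<and> \<phi> v = b)) =
          (\<Sum>a\<in>C. if a = \<phi> u then \<Sum>b\<in>C. if b = \<phi> v then of_bool (a \<noteq> b) * f a b else 0 else 0)"
      proof (rule sum.cong[OF refl])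
        fix a
        have "of_bool (a \<noteq> b) * f a b * of_bool (\<phi> u = a \<and> \<phi> v = b) =
            (if a = \<phi> u then if b = \<phi> v then of_bool (a \<noteq> b) * f a b else 0 else 0)" for b
          by auto
        then show "(\<Sum>b\<in>C. of_bool (a \<noteq> b) * f a b * of_bool (\<phi> u = a \<and> \<phi> v = b)) =
            (if a = \<phi> u then \<Sum>b\<in>C. if b = \<phi> v then of_bool (a \<noteq> b) * f a b else 0 else 0)"
          by (cases "a = \<phi> u") simp_all
      qed
      then show "(\<Sum>a\<in>C. \<Sum>b\<in>C. of_bool (a \<noteq> b) * f a b * of_bool (\<phi> u = a \<and> \<phi> v = b)) =
          of_bool (\<phi> u \<noteq> \<phi> v) * f (\<phi> u) (\<phi> v)"
        using C fC by simp
    qed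
    finally show ?thesis .
  qed
  obtain h where h: "\<forall>a. h a < k"
    "real k * (\<Sum>a\<in>C. \<Sum>b\<in>C-{a}. of_bool (h a = h b) * w a b) \<le> (\<Sum>a\<in>C. \<Sum>b\<in>C-{a}. w a b)"
    using exists_hash[OF fC assms(2), of w] by blast
  have "(\<Sum>a\<in>C. \<Sum>b\<in>C-{a}. w a b) = (\<Sum>u\<in>V. \<Sum>v\<in>V. of_bool (\<phi> u \<noteq> \<phi> v))"
    using swap[of "\<lambda>_ _. 1"] by (simp only: mult_1 mult_1_right)
  also have "\<dots> \<le> (\<Sum>u\<in>V. \<Sum>v\<in>V. 1)" by (intro sum_mono) auto
  finally have "(\<Sum>a\<in>C. \<Sum>b\<in>C-{a}. w a b) \<le> real (card V) ^ 2" by (simp add: power2_eq_square)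
  with h(2) have coll: "(\<Sum>u\<in>V. \<Sum>v\<in>V. of_bool (\<phi> u \<noteq> \<phi> v) * of_bool (h (\<phi> u) = h (\<phi> v)))
      \<le> real (card V) ^ 2 / real k"
    using \<open>k > 0\<close> unfolding swap[of "\<lambda>a b. of_bool (h a = h b)"]
    by (simp add: field_simps)
  have "disagreements V E (h \<circ> \<phi>) \<le> disagreements V E \<phi> +
      (\<Sum>u\<in>V. \<Sum>v\<in>V. of_bool (\<phi> u \<noteq> \<phi> v) * of_bool (h (\<phi> u) = h (\<phi> v)))"
    unfolding disagreements_def sum.distrib[symmetric] by (intro sum_mono) auto
  with coll h(1) show ?thesis by (intro exI[of _ "h \<circ> \<phi>"]) auto
qed

section \<open>Regularised optimum\<close>

text \<open>The Gibbs distribution of the energy \<open>r\<close> on \<open>k\<close> labels,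
  extended by 0 so that it lies in \<open>label_dist k\<close>.\<close>

definition softmax :: "nat \<Rightarrow> (nat \<Rightarrow> real) \<Rightarrow> nat \<Rightarrow> real" where
  "softmax k r i = (if i < k then exp (- r i) / (\<Sum>j<k. exp (- r j)) else 0)"

lemma sum_exp_pos: "(k::nat) > 0 \<Longrightarrow> (\<Sum>j<k. exp (- r j :: real)) > 0"
  by (rule sum_pos) auto

lemma softmax_pos: "i < k \<Longrightarrow> softmax k r i > 0"
  using sum_exp_pos[of k r] by (simp add: softmax_def)

lemma softmax_label_dist:
  assumes "k > 0"
  shows "softmax k r \<in> label_dist k"
proof -
  have "(\<Sum>i<k. softmax k r i) = (\<Sum>i<k. exp (- r i)) / (\<Sum>j<k. exp (- r j))"
    unfolding sum_divide_distrib by (intro sum.cong refl) (simp add: softmax_def)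
  then show ?thesis
    using sum_exp_pos[OF assms, of r]
    by (auto simp: label_dist_def softmax_def intro!: divide_nonneg_nonneg sum_nonneg)
qed

text \<open>The numerator and the normalising sum each change by a factor of at most
  \<open>exp d\<close>, whence \<open>exp (2 * d)\<close>. The bound is multiplicative and does not
  depend on \<open>k\<close>.\<close>

lemma softmax_perturb:
  assumes "\<And>i. i < k \<Longrightarrow> \<bar>r i - s i\<bar> \<le> d"
  shows "softmax k r i \<le> exp (2 * d) * softmax k s i"
proof (cases "i < k")
  case True
  then have "k > 0" by simp
  have "(\<Sum>j<k. exp (- s j)) \<le> (\<Sum>j<k. exp d * exp (- r j))"
  proof (rule sum_mono)
    fix j assume "j \<in> {..<k}"
    then have "- s j \<le> d + - r j" using assms[of j] by auto
    then show "exp (- s j) \<le> exp d * exp (- r j)" by (simp flip: exp_add)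
  qed
  also have "\<dots> = exp d * (\<Sum>j<k. exp (- r j))" by (simp add: sum_distrib_left)
  finally have Z: "(\<Sum>j<k. exp (- s j)) \<le> exp d * (\<Sum>j<k. exp (- r j))" .
  have "- r i \<le> d + - s i" using assms[OF True] by auto
  then have n: "exp (- r i) \<le> exp d * exp (- s i)" by (simp flip: exp_add)
  have "exp (- r i) * (\<Sum>j<k. exp (- s j)) \<le>
      (exp d * exp (- s i)) * (exp d * (\<Sum>j<k. exp (- r j)))"
    using sum_exp_pos[OF \<open>k > 0\<close>, of s] by (intro mult_mono Z n) auto
  also have "\<dots> = exp (2 * d) * exp (- s i) * (\<Sum>j<k. exp (- r j))"
    unfolding exp_double power2_eq_square by (simp only: mult_ac)
  finally have "exp (- r i) * (\<Sum>j<k. exp (- s j)) \<le>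
      exp (2 * d) * exp (- s i) * (\<Sum>j<k. exp (- r j))" .
  then have "exp (- r i) / (\<Sum>j<k. exp (- r j)) \<le> exp (2 * d) * exp (- s i) / (\<Sum>j<k. exp (- s j))"
    by (simp only: pos_divide_le_eq pos_le_divide_eq sum_exp_pos[OF \<open>k > 0\<close>] times_divide_eq_left
        times_divide_eq_right)
  then show ?thesis using True by (simp add: softmax_def)
qed (simp add: softmax_def)

section \<open>Gibbs' variational principle\<close>

lemma relative_entropy_term:
  fixes p q :: real
  assumes "p \<ge> 0" "q > 0"
  shows "p * ln p - p * ln q - p + q \<ge> 0"
    and "p * ln p - p * ln q - p + q = 0 \<Longrightarrow> p = q"
proof -
  have "p * ln p - p * ln q - p + q \<ge> 0 \<and> (p * ln p - p * ln q - p + q = 0 \<longrightarrow> p = q)"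
  proof (cases "p = 0")
    case False
    with assms have p: "p > 0" by simp
    \<comment> \<open>Dividing by \<open>p\<close> turns the claim into
      \<open>ln t \<le> t - 1\<close>, with equality only at \<open>t = 1\<close>.\<close>
    define t where "t = q / p"
    have t: "t > 0" "q = t * p" using p assms by (auto simp: t_def)
    have eq: "p * ln p - p * ln q - p + q = p * (t - 1 - ln t)"
      using t p by (simp add: ln_mult algebra_simps)
    have "ln t \<le> t - 1" using t(1) by (rule ln_le_minus_one)
    moreover have "ln t = t - 1 \<Longrightarrow> t = 1" using t(1) by (rule ln_eq_minus_one)
    ultimately show ?thesis unfolding eq using p t by auto
  qed (use assms in auto)
  then show "p * ln p - p * ln q - p + q \<ge> 0"
    and "p * ln p - p * ln q - p + q = 0 \<Longrightarrow> p = q" by auto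
qed

text \<open>The free energy of \<open>p\<close> equals the relative entropy of \<open>p\<close> with
  respect to the softmax \<open>q\<close>, minus \<open>ln Z\<close>. Minimality therefore forces
  the relative entropy to be 0; its terms, completed by \<open>- p i + q i\<close>, are nonnegative
  and vanish only where \<open>p\<close> and \<open>q\<close> coincide.\<close>

lemma softmax_unique_minimiser:
  assumes "k > 0" "p \<in> label_dist k"
    and min: "\<And>q. q \<in> label_dist k \<Longrightarrow>
      (\<Sum>i<k. p i * r i + p i * ln (p i)) \<le> (\<Sum>i<k. q i * r i + q i * ln (q i))"
  shows "p = softmax k r"
proof -
  define q where "q = softmax k r"
  define Z where "Z = (\<Sum>j<k. exp (- r j))"
  have Z: "Z > 0" using sum_exp_pos[OF assms(1)] by (simp add: Z_def)
  have q: "q \<in> label_dist k" "\<And>i. i < k \<Longrightarrow> q i > 0"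
    using softmax_label_dist[OF assms(1)] softmax_pos by (auto simp: q_def)
  have r: "r i = - ln (q i) - ln Z" if "i < k" for i
    using that Z by (simp add: q_def softmax_def ln_div flip: Z_def)
  \<comment> \<open>The added terms \<open>- s i + q i\<close> cancel in the sum because both
    vectors have total mass 1.\<close>
  have free: "(\<Sum>i<k. s i * r i + s i * ln (s i)) =
      (\<Sum>i<k. s i * ln (s i) - s i * ln (q i) - s i + q i) - ln Z" if "s \<in> label_dist k" for s
  proof -
    have "(\<Sum>i<k. s i * r i + s i * ln (s i)) =
        (\<Sum>i<k. (s i * ln (s i) - s i * ln (q i) - s i + q i) + (s i - q i - s i * ln Z))"
      by (intro sum.cong refl) (simp add: r algebra_simps)
    then show ?thesis
      using label_dist_sum[OF that] label_dist_sum[OF q(1)]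
      by (simp add: sum.distrib sum_subtractf sum_negf flip: sum_distrib_right)
  qed
  let ?f = "\<lambda>i. p i * ln (p i) - p i * ln (q i) - p i + q i"
  have "(\<Sum>i<k. ?f i) \<le> 0"
    using min[OF q(1)] unfolding free[OF assms(2)] free[OF q(1)] by simp
  moreover have nn: "\<forall>i\<in>{..<k}. 0 \<le> ?f i"
    using relative_entropy_term(1) q(2) label_dist_nonneg[OF assms(2)] by blast
  ultimately have "\<forall>i\<in>{..<k}. ?f i = 0"
    by (metis (no_types, lifting) finite_lessThan order_antisym sum_nonneg sum_nonneg_eq_0_iff)
  then have "p i = q i" if "i < k" for i
    using relative_entropy_term(2)[of "p i" "q i"] that q(2) label_dist_nonneg[OF assms(2)] by simp
  moreover have "p i = q i" if "i \<ge> k" for i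
    using that label_dist_zero[OF assms(2)] label_dist_zero[OF q(1)] by simp
  ultimately show ?thesis unfolding q_def by (metis ext linorder_not_less)
qed

section \<open>Compactness and continuity for the existence of a minimiser\<close>

lemma compact_fun:
  fixes S :: "'a \<Rightarrow> 'b::topological_space set"
  assumes "\<And>i. compact (S i)"
  shows "compact {f. \<forall>i. f i \<in> S i}"
proof -
  have "compactin (product_topology (\<lambda>_. euclidean) UNIV) (PiE UNIV S)"
    using assms by (simp add: compactin_PiE)
  moreover have "PiE UNIV S = {f. \<forall>i. f i \<in> S i}" by auto
  ultimately show ?thesis by (simp add: euclidean_product_topology)
qed

lemma compact_label_dist: "compact (label_dist k)"
proof -
  define S :: "nat \<Rightarrow> real set" where "S i = (if i < k then {0..1} else {0})" for i
  have "compact {f. \<forall>i. f i \<in> S i}"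
    by (rule compact_fun) (simp add: S_def)
  moreover have "closed {p :: nat \<Rightarrow> real. (\<Sum>i<k. p i) = 1}"
    by (intro closed_Collect_eq continuous_intros continuous_on_product_coordinates)
  ultimately have "compact ({f. \<forall>i. f i \<in> S i} \<inter> {p. (\<Sum>i<k. p i) = 1})"
    by (rule compact_Int_closed)
  also have "{f. \<forall>i. f i \<in> S i} \<inter> {p. (\<Sum>i<k. p i) = 1} = label_dist k"
  proof (intro set_eqI iffI)
    fix p assume "p \<in> {f. \<forall>i. f i \<in> S i} \<inter> {p. (\<Sum>i<k. p i) = 1}"
    then have "\<And>i. p i \<in> S i" "(\<Sum>i<k. p i) = 1" by auto
    then show "p \<in> label_dist k"
      unfolding label_dist_def S_def
      by (smt (verit, best) atLeastAtMost_iff linorder_not_less mem_Collect_eq singletonD)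
  next
    fix p assume p: "p \<in> label_dist k"
    then show "p \<in> {f. \<forall>i. f i \<in> S i} \<inter> {p. (\<Sum>i<k. p i) = 1}"
      using label_dist_nonneg[OF p] label_dist_le_1[OF p] label_dist_zero[OF p] label_dist_sum[OF p]
      by (auto simp: S_def)
  qed
  finally show ?thesis .
qed

text \<open>Only the point 0 needs care: there the expression has value 0, which is also its limit
  from the right.\<close>

lemma continuous_on_xlnx: "continuous_on {0..1} (\<lambda>x::real. x * ln x)"
  unfolding continuous_on_def
proof
  fix x :: real assume x: "x \<in> {0..1}"
  show "((\<lambda>x. x * ln x) \<longlongrightarrow> x * ln x) (at x within {0..1})"
  proof (cases "x = 0")
    case True
    have "((\<lambda>x::real. x * ln x) \<longlongrightarrow> 0) (at_right 0)" by real_asymp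
    then show ?thesis using True by (simp add: at_within_Icc_at_right)
  next
    case False
    then show ?thesis using x by (intro tendsto_intros) auto
  qed
qed

lemma xlnx_bounds:
  fixes x :: real
  assumes "0 \<le> x" "x \<le> 1"
  shows "- 1 \<le> x * ln x" "x * ln x \<le> 0"
proof -
  show "- 1 \<le> x * ln x"
    using relative_entropy_term(1)[of x 1] assms by simp
  show "x * ln x \<le> 0"
    using assms by (cases "x = 0") (auto intro!: mult_nonneg_nonpos)
qed

text \<open>Minimise the cost plus an entropy term: as the cost is affine in \<open>x v\<close>, Gibbs' variational
  principle identifies the \<open>v\<close>-th coordinate of the minimiser.\<close>

lemma exists_softmax_fixpoint:
  fixes V :: "'a set"
  assumes V: "finite V" "symp E" and "k > 0" "c > 0"
  shows "\<exists>x. (\<forall>v. x v \<in> label_dist k) \<and> (\<forall>v\<in>V. x v = softmax k (\<lambda>i. 2 * pull V E x v i / c)) \<and>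
    (\<forall>y. (\<forall>v. y v \<in> label_dist k) \<longrightarrow>
       total_cost V E k x \<le> total_cost V E k y + c * real (card V) * real k)"
proof -
  \<comment> \<open>The constraint is imposed on all of \<open>'a\<close>, not just on
    \<open>V\<close>. By Tychonoff \<open>K\<close> is compact in the product topology even when
    \<open>'a\<close> is infinite, and \<open>F\<close> depends on finitely many
    coordinates.\<close>
  define K :: "('a \<Rightarrow> nat \<Rightarrow> real) set" where "K = {x. \<forall>v. x v \<in> label_dist k}"
  define H where "H p = (\<Sum>i<k. p i * ln (p i))" for p :: "nat \<Rightarrow> real"
  define F where "F x = total_cost V E k x + c * (\<Sum>v\<in>V. H (x v))" for x
  have "compact K" unfolding K_def by (intro compact_fun compact_label_dist)
  moreover have "(\<lambda>_. one_hot 0) \<in> K" using one_hot_label_dist[OF \<open>k > 0\<close>] by (simp add: K_def)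
  moreover have "continuous_on K F"
  proof -
    have coord: "continuous_on K (\<lambda>x. x v i)" for v i
      by (rule continuous_on_product_then_coordinatewise,
          rule continuous_on_product_then_coordinatewise, rule continuous_on_id)
    have "continuous_on K (\<lambda>x. x v i * ln (x v i))" for v i
      by (rule continuous_on_compose2[OF continuous_on_xlnx coord])
         (auto simp: K_def label_dist_nonneg[of "_ v" k] label_dist_le_1[of "_ v" k])
    moreover have "continuous_on K (\<lambda>x. pair_cost E k x u v)" for u v
      unfolding pair_cost_eq_sign agree_def by (intro continuous_intros coord)
    ultimately show ?thesis
      unfolding F_def total_cost_def H_def
      by (intro continuous_on_add continuous_on_sum continuous_on_mult_left)
  qed
  ultimately obtain x where x: "x \<in> K" and le: "\<And>y. y \<in> K \<Longrightarrow> F x \<le> F y"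
    using continuous_attains_inf[of K F] by blast
  have xK: "\<And>v. x v \<in> label_dist k" using x by (simp add: K_def)
  have "x v = softmax k (\<lambda>i. 2 * pull V E x v i / c)" if v: "v \<in> V" for v
  \<comment> \<open>Changing \<open>x v\<close> alone alters \<open>F\<close> by an affine term with
    slope \<open>2 * pull V E x v\<close> and by the entropy term of \<open>v\<close>. After
    division by \<open>c\<close> this is the free energy with energy
    \<open>2 * pull V E x v i / c\<close>.\<close>
  proof (rule softmax_unique_minimiser[OF \<open>k > 0\<close> xK])
    fix q assume q: "q \<in> label_dist k"
    have "x(v := q) \<in> K" using q xK by (simp add: K_def)
    then have "F x \<le> F (x(v := q))" by (rule le)
    moreover have "total_cost V E k (x(v := q)) =
        total_cost V E k x + 2 * (\<Sum>i<k. (q i - x v i) * pull V E x v i)"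
      using total_cost_update[OF V(1) v V(2), of k x q "x v"] by simp
    moreover have "(\<Sum>u\<in>V. H ((x(v := q)) u)) = H q + (\<Sum>u\<in>V-{v}. H (x u))"
    proof -
      have "(\<Sum>u\<in>V. H ((x(v := q)) u)) = H ((x(v := q)) v) + (\<Sum>u\<in>V-{v}. H ((x(v := q)) u))"
        by (rule sum.remove[OF V(1) v])
      also have "(\<Sum>u\<in>V-{v}. H ((x(v := q)) u)) = (\<Sum>u\<in>V-{v}. H (x u))"
        by (intro sum.cong refl) simp
      finally show ?thesis by simp
    qed
    moreover have "(\<Sum>u\<in>V. H (x u)) = H (x v) + (\<Sum>u\<in>V-{v}. H (x u))"
      by (rule sum.remove[OF V(1) v])
    ultimately have "c * H (x v) \<le> 2 * (\<Sum>i<k. (q i - x v i) * pull V E x v i) + c * H q"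
      by (simp add: F_def distrib_left)
    then have "c * H (x v) + 2 * (\<Sum>i<k. x v i * pull V E x v i) \<le>
        c * H q + 2 * (\<Sum>i<k. q i * pull V E x v i)"
      by (simp add: left_diff_distrib sum_subtractf)
    moreover have "(\<Sum>i<k. p i * (2 * pull V E x v i / c) + p i * ln (p i)) =
        (c * H p + 2 * (\<Sum>i<k. p i * pull V E x v i)) / c" for p
      using \<open>c > 0\<close>
      by (simp add: sum.distrib H_def add_divide_distrib sum_distrib_left sum_divide_distrib mult_ac)
    ultimately show "(\<Sum>i<k. x v i * (2 * pull V E x v i / c) + x v i * ln (x v i)) \<le>
        (\<Sum>i<k. q i * (2 * pull V E x v i / c) + q i * ln (q i))"
      using \<open>c > 0\<close> by (simp only: divide_right_mono less_imp_le)
  qed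
  \<comment> \<open>The entropy term \<open>H\<close> lies between \<open>- real k\<close> and 0, by
    the crude bound -1 for each \<open>x * ln x\<close>. So the regularisation moves the optimum by
    at most \<open>c * real k\<close> per vertex.\<close>
  moreover have "total_cost V E k x \<le> total_cost V E k y + c * real (card V) * real k"
    if y: "\<forall>v. y v \<in> label_dist k" for y
  proof -
    have "F x \<le> F y" using y by (intro le) (simp add: K_def)
    moreover have "H (y v) \<le> 0" for v
      unfolding H_def using y
      by (intro sum_nonpos xlnx_bounds) (auto intro: label_dist_nonneg label_dist_le_1)
    then have "(\<Sum>v\<in>V. H (y v)) \<le> 0" by (intro sum_nonpos)
    then have "c * (\<Sum>v\<in>V. H (y v)) \<le> 0" using \<open>c > 0\<close> by (simp add: mult_le_0_iff)
    moreover have "- real k \<le> H (x v)" for v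
    proof -
      have "(\<Sum>i<k. - 1) \<le> H (x v)"
        unfolding H_def using xK
        by (intro sum_mono xlnx_bounds) (auto intro: label_dist_nonneg label_dist_le_1)
      then show ?thesis by simp
    qed
    then have "(\<Sum>v\<in>V. - real k) \<le> (\<Sum>v\<in>V. H (x v))" by (intro sum_mono)
    then have "c * (- (real (card V) * real k)) \<le> c * (\<Sum>v\<in>V. H (x v))"
      using \<open>c > 0\<close> by (intro mult_left_mono) auto
    ultimately show ?thesis by (simp add: F_def algebra_simps)
  qed
  ultimately show ?thesis using xK by blast
qed

section \<open>Stability of the cost under multiplicative perturbation\<close>

lemma agree_perturb:
  assumes x: "\<And>i. p i \<le> a * p' i" "\<And>i. q i \<le> a * q' i"
    and "p \<in> label_dist k" "q \<in> label_dist k" "p' \<in> label_dist k" "q' \<in> label_dist k" "a \<ge> 1"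
  shows "agree k p q \<le> agree k p' q' + (a\<^sup>2 - 1)"
proof -
  have "agree k p q \<le> (\<Sum>i<k. (a * p' i) * (a * q' i))"
    unfolding agree_def using assms
    by (intro sum_mono mult_mono) (auto intro: label_dist_nonneg mult_nonneg_nonneg)
  also have "\<dots> = a\<^sup>2 * agree k p' q'"
    by (simp add: agree_def sum_distrib_left power2_eq_square mult_ac)
  also have "\<dots> = agree k p' q' + (a\<^sup>2 - 1) * agree k p' q'" by (simp add: algebra_simps)
  also have "\<dots> \<le> agree k p' q' + (a\<^sup>2 - 1) * 1"
    using assms agree_bounds by (intro add_left_mono mult_left_mono) auto
  finally show ?thesis by simp
qed

text \<open>A pair that avoids the exceptional set \<open>B\<close> changes its cost by at most
  \<open>a\<^sup>2 - 1\<close>; a pair that meets \<open>B\<close> changes it by at most 1, and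
  there are at most \<open>2 * card V * card B\<close> of these. Closeness is required in both
  directions because \<open>agree\<close> enters with opposite signs for edges and
  non-edges.\<close>

lemma total_cost_perturb:
  assumes V: "finite V"
    and x: "\<And>v. x v \<in> label_dist k" and y: "\<And>v. y v \<in> label_dist k"
    and close: "\<And>v i. v \<in> V - B \<Longrightarrow> x v i \<le> a * y v i \<and> y v i \<le> a * x v i"
    and "B \<subseteq> V" "a \<ge> 1"
  shows "total_cost V E k y \<le>
    total_cost V E k x + real (card V) ^ 2 * (a\<^sup>2 - 1) + 2 * real (card V) * real (card B)"
proof -
  have "pair_cost E k y u v \<le> pair_cost E k x u v + (a\<^sup>2 - 1) + of_bool (u \<in> B) + of_bool (v \<in> B)"
    if "u \<in> V" "v \<in> V" for u v
  proof (cases "u \<in> B \<or> v \<in> B")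
    case True
    have "pair_cost E k y u v \<le> 1" "0 \<le> pair_cost E k x u v" "0 \<le> a\<^sup>2 - 1"
      using pair_cost_bounds[OF y] pair_cost_bounds[OF x] \<open>a \<ge> 1\<close> by auto
    then show ?thesis using True by auto
  next
    case False
    then have "agree k (y u) (y v) \<le> agree k (x u) (x v) + (a\<^sup>2 - 1)"
      "agree k (x u) (x v) \<le> agree k (y u) (y v) + (a\<^sup>2 - 1)"
      using that close by (intro agree_perturb x y \<open>a \<ge> 1\<close>; simp)+
    then show ?thesis using False \<open>a \<ge> 1\<close> by (auto simp: pair_cost_def)
  qed
  then have "total_cost V E k y \<le> (\<Sum>u\<in>V. \<Sum>v\<in>V. pair_cost E k x u v + (a\<^sup>2 - 1) + of_bool (u \<in> B) + of_bool (v \<in> B))"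
    unfolding total_cost_def by (intro sum_mono)
  also have "\<dots> = total_cost V E k x + real (card V) ^ 2 * (a\<^sup>2 - 1) + 2 * real (card V) * real (card B)"
    using V \<open>B \<subseteq> V\<close> by (simp add: sum.distrib total_cost_def power2_eq_square Int_absorb1 Int_absorb2
      flip: sum_distrib_left)
  finally show ?thesis .
qed

section \<open>Induced \<open>P\<^sub>3\<close>-free graphs are cluster graphs\<close>

definition cluster_graph :: "'a set \<Rightarrow> ('a \<Rightarrow> nat) \<Rightarrow> 'a graph" where
  "cluster_graph V \<phi> = (V, {{u, v} | u v. u \<in> V \<and> v \<in> V \<and> u \<noteq> v \<and> \<phi> u = \<phi> v})"

lemma adjacent_cluster_graph:
  "adjacent (cluster_graph V \<phi>) u v \<longleftrightarrow> u \<in> V \<and> v \<in> V \<and> u \<noteq> v \<and> \<phi> u = \<phi> v"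
  by (auto simp: adjacent_def cluster_graph_def doubleton_eq_iff)

lemma adjacent_sym: "symp (adjacent G)"
  by (auto simp: symp_def adjacent_def insert_commute)

lemma adjacent_induced_subgraph:
  "adjacent (induced_subgraph G S) u v \<longleftrightarrow> adjacent G u v \<and> u \<in> S \<and> v \<in> S"
  by (auto simp: adjacent_def induced_subgraph_def)

lemma adjacent_irrefl: "simple_graph G \<Longrightarrow> \<not> adjacent G u u"
  by (auto simp: simple_graph_def adjacent_def)

lemma adjacent_P3:
  "adjacent P3 0 1" "adjacent P3 1 2" "\<not> adjacent P3 0 2"
  by (auto simp: adjacent_def P3_def doubleton_eq_iff)

text \<open>Having equal labels is transitive, so the two ends of a path on three vertices would be
  adjacent.\<close>

lemma cluster_graph_P3_free:
  assumes "finite V"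
  shows "cluster_graph V \<phi> \<in> induced_free P3"
proof -
  have "simple_graph (cluster_graph V \<phi>)"
    using assms by (auto simp: simple_graph_def cluster_graph_def)
  moreover have False if "graph_isomorphic (induced_subgraph (cluster_graph V \<phi>) S) P3" for S
  proof -
    have "verts (induced_subgraph (cluster_graph V \<phi>) S) = S" "verts P3 = {0, 1, 2}"
      by (simp_all add: induced_subgraph_def P3_def)
    with that obtain f where f: "bij_betw f S {0, 1, 2::nat}"
      and adj: "\<forall>u\<in>S. \<forall>v\<in>S.
        adjacent (induced_subgraph (cluster_graph V \<phi>) S) u v \<longleftrightarrow> adjacent P3 (f u) (f v)"
      unfolding graph_isomorphic_def by metis
    have "f ` S = {0, 1, 2}" using f by (rule bij_betw_imp_surj_on)
    then obtain a b c where abc: "a \<in> S" "b \<in> S" "c \<in> S" "f a = 0" "f b = 1" "f c = 2"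
      by (metis imageE insertCI)
    have "adjacent (cluster_graph V \<phi>) a b" "adjacent (cluster_graph V \<phi>) b c"
      "\<not> adjacent (cluster_graph V \<phi>) a c"
      using adj abc adjacent_P3 by (simp_all add: adjacent_induced_subgraph)
    moreover have "a \<noteq> c" using abc by auto
    ultimately show False by (auto simp: adjacent_cluster_graph)
  qed
  ultimately show ?thesis by (auto simp: induced_free_def)
qed

lemma P3_free_trans:
  assumes G: "G \<in> induced_free P3"
    and "adjacent G u v" "adjacent G v w" "u \<noteq> w"
  shows "adjacent G u w"
proof (rule ccontr)
  assume nadj: "\<not> adjacent G u w"
  have simple: "simple_graph G" using G by (simp add: induced_free_def)
  \<comment> \<open>If \<open>u\<close> and \<open>w\<close> were not adjacent, \<open>f\<close>
    would be an isomorphism from the subgraph induced by \<open>u\<close>, \<open>v\<close>,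
    \<open>w\<close> onto \<open>P3\<close>, with \<open>v\<close> as the middle vertex.\<close>
  define f :: "'a \<Rightarrow> nat" where "f x = (if x = u then 0 else if x = v then 1 else 2)" for x
  let ?S = "{u, v, w}"
  have ne: "u \<noteq> v" "v \<noteq> w" using assms adjacent_irrefl[OF simple] by auto
  have sub: "?S \<subseteq> verts G" using assms simple by (auto simp: simple_graph_def adjacent_def)
  have sym: "adjacent G v u" "adjacent G w v" "\<not> adjacent G w u"
    using adjacent_sym[of G] assms nadj by (auto simp: symp_def)
  have "bij_betw f ?S (verts P3)"
    unfolding bij_betw_def P3_def using ne \<open>u \<noteq> w\<close> by (auto simp: f_def inj_on_def)
  moreover have "\<forall>a\<in>?S. \<forall>b\<in>?S. adjacent (induced_subgraph G ?S) a b \<longleftrightarrow> adjacent P3 (f a) (f b)"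
    using ne \<open>u \<noteq> w\<close> assms(2,3) nadj sym adjacent_irrefl[OF simple]
    by (auto simp: adjacent_induced_subgraph f_def)
       (auto simp: adjacent_def P3_def doubleton_eq_iff)
  ultimately have "graph_isomorphic (induced_subgraph G ?S) P3"
    unfolding graph_isomorphic_def by (intro exI[of _ f]) (simp add: induced_subgraph_def)
  then show False using G sub unfolding induced_free_def by blast
qed

text \<open>Equality or adjacency is an equivalence relation, and each class is labelled by its
  least element. Numbers that are not vertices form singleton classes, so the equivalence holds for
  all \<open>u\<close> and \<open>v\<close>.\<close>

lemma P3_free_clusters:
  fixes G :: "nat graph"
  assumes "G \<in> induced_free P3"
  shows "\<exists>\<phi> :: nat \<Rightarrow> nat. \<forall>u v. u \<noteq> v \<longrightarrow> (adjacent G u v \<longleftrightarrow> \<phi> u = \<phi> v)"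
proof -
  have sym: "adjacent G u v \<longleftrightarrow> adjacent G v u" for u v
    using adjacent_sym[of G] by (auto simp: symp_def)
  have tr: "adjacent G u v \<Longrightarrow> adjacent G v w \<Longrightarrow> u \<noteq> w \<Longrightarrow> adjacent G u w" for u v w
    by (rule P3_free_trans[OF assms])
  define \<phi> where "\<phi> u = (LEAST w. w = u \<or> adjacent G u w)" for u
  have \<phi>: "\<phi> u = u \<or> adjacent G u (\<phi> u)" for u
    unfolding \<phi>_def by (rule LeastI[of _ u]) simp
  have "adjacent G u v \<longleftrightarrow> \<phi> u = \<phi> v" if "u \<noteq> v" for u v
  proof
    assume "adjacent G u v"
    then have "(w = u \<or> adjacent G u w) = (w = v \<or> adjacent G v w)" for w
      using tr[of u v w] tr[of v u w] sym that by blast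
    then show "\<phi> u = \<phi> v" unfolding \<phi>_def by simp
  next
    assume "\<phi> u = \<phi> v"
    then obtain m where "m = u \<or> adjacent G u m" "m = v \<or> adjacent G v m"
      using \<phi>[of u] \<phi>[of v] by auto
    moreover have "adjacent G v m \<Longrightarrow> adjacent G m v" using sym by simp
    ultimately show "adjacent G u v" using tr[of u m v] that by metis
  qed
  then show ?thesis by (intro exI[of _ \<phi>]) simp
qed

section \<open>Distance to \<open>P\<^sub>3\<close>-freeness as a clustering cost\<close>

lemma sum_ordered_pairs:
  assumes V: "finite V" and D: "finite D" "\<And>e. e \<in> D \<Longrightarrow> e \<subseteq> V \<and> card e = 2"
  shows "(\<Sum>u\<in>V. \<Sum>v\<in>V. of_bool ({u, v} \<in> D)) = 2 * real (card D)"
  using D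
proof (induction D rule: finite_induct)
  case (insert e D)
  obtain a b where e: "e = {a, b}" "a \<noteq> b" "a \<in> V" "b \<in> V"
    using insert.prems[of e] by (auto simp: card_2_iff)
  have "(\<Sum>u\<in>V. \<Sum>v\<in>V. of_bool ({u, v} = e)) = (\<Sum>p\<in>V\<times>V. of_bool ({fst p, snd p} = e) :: real)"
    by (simp only: sum.cartesian_product' fst_conv snd_conv)
  also have "\<dots> = real (card {p \<in> V \<times> V. {fst p, snd p} = e})"
    using V by (simp add: Int_def)
  also have "{p \<in> V \<times> V. {fst p, snd p} = e} = {(a, b), (b, a)}"
    using e by (auto simp: doubleton_eq_iff)
  finally have "(\<Sum>u\<in>V. \<Sum>v\<in>V. of_bool ({u, v} = e) :: real) = 2" using e by simp
  moreover have "(of_bool ({u, v} \<in> insert e D) :: real) = of_bool ({u, v} = e) + of_bool ({u, v} \<in> D)" for u v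
    using insert.hyps by auto
  ultimately show ?case
    using insert by (simp add: sum.distrib)
qed simp

text \<open>Every edge of the symmetric difference is met by two ordered pairs, hence the 2 in the
  denominator. The same 2 recurs wherever a clustering cost is compared with a distance.\<close>

lemma graph_dist_eq_sum:
  assumes "simple_graph G" "simple_graph G'" "verts G' = verts G"
  shows "graph_dist G G' =
    (\<Sum>u\<in>verts G. \<Sum>v\<in>verts G. of_bool (adjacent G u v \<noteq> adjacent G' u v)) / (2 * real (card (verts G)) ^ 2)"
proof -
  have "finite (verts G)" "edges G \<subseteq> Pow (verts G)" "edges G' \<subseteq> Pow (verts G)"
    using assms by (auto simp: simple_graph_def)
  then have fin: "finite (verts G)" "finite (edges G)" "finite (edges G')"
    by (auto intro: finite_subset)
  let ?D = "(edges G - edges G') \<union> (edges G' - edges G)"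
  have card: "card ?D = card (edges G - edges G') + card (edges G' - edges G)"
    by (rule card_Un_disjoint) (use fin in auto)
  have "(\<Sum>u\<in>verts G. \<Sum>v\<in>verts G. of_bool (adjacent G u v \<noteq> adjacent G' u v)) =
      (\<Sum>u\<in>verts G. \<Sum>v\<in>verts G. of_bool ({u, v} \<in> ?D) :: real)"
    by (intro sum.cong refl) (auto simp: adjacent_def)
  also have "\<dots> = 2 * real (card ?D)"
    by (rule sum_ordered_pairs) (use fin assms in \<open>auto simp: simple_graph_def\<close>)
  finally show ?thesis by (simp add: graph_dist_def flip: card)
qed

text \<open>Finiteness is what gives the \<open>Min\<close> in \<open>dist_to_property\<close> its
  meaning.\<close>

lemma dist_set_finite:
  assumes "simple_graph G"
  shows "finite {graph_dist G G' | G'. G' \<in> induced_free H \<and> verts G' = verts G}"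
proof -
  have "{graph_dist G G' | G'. G' \<in> induced_free H \<and> verts G' = verts G}
      \<subseteq> graph_dist G ` ({verts G} \<times> Pow (Pow (verts G)))"
  proof
    fix d assume "d \<in> {graph_dist G G' | G'. G' \<in> induced_free H \<and> verts G' = verts G}"
    then obtain G' where G': "d = graph_dist G G'" "simple_graph G'" "verts G' = verts G"
      by (auto simp: induced_free_def)
    then have "G' \<in> {verts G} \<times> Pow (Pow (verts G))"
      by (cases G') (auto simp: simple_graph_def)
    then show "d \<in> graph_dist G ` ({verts G} \<times> Pow (Pow (verts G)))" using G'(1) by blast
  qed
  then show ?thesis
    by (rule finite_subset) (use assms in \<open>simp add: simple_graph_def\<close>)
qed

lemma dist_P3_free_le:
  assumes "simple_graph G"
  shows "dist_to_property G (induced_free P3) \<le>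
    disagreements (verts G) (adjacent G) \<phi> / (2 * real (card (verts G)) ^ 2)"
proof -
  have fin: "finite (verts G)" using assms by (simp add: simple_graph_def)
  let ?G' = "cluster_graph (verts G) \<phi>"
  have free: "?G' \<in> induced_free P3" by (rule cluster_graph_P3_free[OF fin])
  have verts: "verts ?G' = verts G" by (simp add: cluster_graph_def)
  have "dist_to_property G (induced_free P3) \<le> graph_dist G ?G'"
    unfolding dist_to_property_def by (rule Min_le[OF dist_set_finite[OF assms]]) (use free verts in blast)
  also have "graph_dist G ?G' = disagreements (verts G) (adjacent G) \<phi> / (2 * real (card (verts G)) ^ 2)"
  proof -
    have "simple_graph ?G'" using free by (simp add: induced_free_def)
    show ?thesis
      unfolding disagreements_def
      unfolding graph_dist_eq_sum[OF assms \<open>simple_graph ?G'\<close> verts] adjacent_cluster_graph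
      using adjacent_irrefl[OF assms]
      by (intro arg_cong2[where f = "(/)"] sum.cong refl) auto
  qed
  finally show ?thesis .
qed

text \<open>A closest \<open>P\<^sub>3\<close>-free graph is a cluster graph, and its clusters serve
  as \<open>\<phi>\<close>. Together with \<open>dist_P3_free_le\<close> this makes the distance the
  minimal normalised disagreement.\<close>

lemma dist_P3_free_attained:
  fixes G :: "nat graph"
  assumes "simple_graph G"
  shows "\<exists>\<phi>. dist_to_property G (induced_free P3) =
    disagreements (verts G) (adjacent G) \<phi> / (2 * real (card (verts G)) ^ 2)"
proof -
  let ?D = "{graph_dist G G' | G'. G' \<in> induced_free P3 \<and> verts G' = verts G}"
  have "cluster_graph (verts G) (\<lambda>_. 0) \<in> induced_free P3"
    by (rule cluster_graph_P3_free) (use assms in \<open>simp add: simple_graph_def\<close>)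
  moreover have "verts (cluster_graph (verts G) (\<lambda>_. 0)) = verts G" by (simp add: cluster_graph_def)
  ultimately have "?D \<noteq> {}" by blast
  then have "dist_to_property G (induced_free P3) \<in> ?D"
    unfolding dist_to_property_def by (rule Min_in[OF dist_set_finite[OF assms]])
  then obtain G' where G': "dist_to_property G (induced_free P3) = graph_dist G G'"
    "G' \<in> induced_free P3" "verts G' = verts G" by blast
  then have simple: "simple_graph G'" by (simp add: induced_free_def)
  obtain \<phi> :: "nat \<Rightarrow> nat" where \<phi>: "\<forall>u v. u \<noteq> v \<longrightarrow> (adjacent G' u v \<longleftrightarrow> \<phi> u = \<phi> v)"
    using P3_free_clusters[OF G'(2)] ..
  have "(adjacent G u v \<noteq> adjacent G' u v) \<longleftrightarrow> (u \<noteq> v \<and> adjacent G u v \<noteq> (\<phi> u = \<phi> v))" for u v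
    using adjacent_irrefl[OF assms] adjacent_irrefl[OF simple] by (cases "u = v") (simp_all add: \<phi>)
  then have "graph_dist G G' = disagreements (verts G) (adjacent G) \<phi> / (2 * real (card (verts G)) ^ 2)"
    by (simp only: graph_dist_eq_sum[OF assms simple G'(3)] disagreements_def)
  then show ?thesis using G'(1) by (intro exI[of _ \<phi>]) simp
qed

section \<open>Sampling\<close>

definition iid :: "nat \<Rightarrow> 'a \<Rightarrow> 'a pmf \<Rightarrow> (nat \<Rightarrow> 'a) pmf" where
  "iid s d p = Pi_pmf {..<s} d (\<lambda>_. p)"

lemma iid_Hoeffding:
  assumes h: "\<And>x. a \<le> h x \<and> h x \<le> (b :: real)" and "a < b" "s > 0" "\<delta> \<ge> 0"
  shows "measure_pmf.prob (iid s d p)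
      {X. \<delta> \<le> \<bar>(\<Sum>j<s. h (X j)) / real s - measure_pmf.expectation p h\<bar>}
    \<le> 2 * exp (- 2 * real s * \<delta>\<^sup>2 / (b - a)\<^sup>2)"
proof -
  let ?P = "Pi_pmf {..<s} d (\<lambda>_. p)"
  let ?m = "measure_pmf.expectation p h"
  have mean: "measure_pmf.expectation ?P (\<lambda>X. h (X j)) = ?m" if "j < s" for j
  proof -
    have "measure_pmf.expectation (map_pmf (\<lambda>X. X j) ?P) h = ?m"
      using that by (simp only: Pi_pmf_component finite_lessThan lessThan_iff if_True)
    then show ?thesis by simp
  qed
  interpret H: Hoeffding_ineq "measure_pmf ?P" "{..<s}" "\<lambda>j X. h (X j)" "\<lambda>_. a" "\<lambda>_. b"
    "\<Sum>j<s. measure_pmf.expectation ?P (\<lambda>X. h (X j))"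
  proof unfold_locales
    show "prob_space.indep_vars (measure_pmf ?P) (\<lambda>_. borel) (\<lambda>j X. h (X j)) {..<s}"
      by (rule prob_space.indep_vars_compose2[OF measure_pmf.prob_space_axioms indep_vars_Pi_pmf]) auto
  qed (use h in auto)
  have sum_mean: "(\<Sum>j<s. measure_pmf.expectation ?P (\<lambda>X. h (X j))) = real s * ?m"
    by (simp add: mean)
  have pos: "(\<Sum>j<s. (b - a)\<^sup>2) > 0" using \<open>a < b\<close> \<open>s > 0\<close> by simp
  \<comment> \<open>A deviation \<open>\<delta>\<close> of the empirical mean is a deviation
    \<open>s * \<delta>\<close> of the sum, the form in which Hoeffding's inequality
    applies.\<close>
  have "{X. \<delta> \<le> \<bar>(\<Sum>j<s. h (X j)) / real s - ?m\<bar>} =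
      {X \<in> space (measure_pmf ?P). \<bar>(\<Sum>j<s. h (X j)) - real s * ?m\<bar> \<ge> real s * \<delta>}"
  proof (intro set_eqI)
    fix X :: "nat \<Rightarrow> 'a"
    have "(\<Sum>j<s. h (X j)) / real s - ?m = ((\<Sum>j<s. h (X j)) - real s * ?m) / real s"
      using \<open>s > 0\<close> by (simp add: diff_divide_distrib)
    then have "\<bar>(\<Sum>j<s. h (X j)) / real s - ?m\<bar> = \<bar>(\<Sum>j<s. h (X j)) - real s * ?m\<bar> / real s"
      by simp
    then show "X \<in> {X. \<delta> \<le> \<bar>(\<Sum>j<s. h (X j)) / real s - ?m\<bar>} \<longleftrightarrow>
        X \<in> {X \<in> space (measure_pmf ?P). \<bar>(\<Sum>j<s. h (X j)) - real s * ?m\<bar> \<ge> real s * \<delta>}"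
      using \<open>s > 0\<close> by (simp add: pos_le_divide_eq mult.commute)
  qed
  then have "measure_pmf.prob ?P {X. \<delta> \<le> \<bar>(\<Sum>j<s. h (X j)) / real s - ?m\<bar>} \<le>
      2 * exp (- 2 * (real s * \<delta>)\<^sup>2 / (\<Sum>j<s. (b - a)\<^sup>2))"
    using H.Hoeffding_ineq_abs_ge[OF _ pos, of "real s * \<delta>"] \<open>\<delta> \<ge> 0\<close> by (simp only: sum_mean) simp
  also have "- 2 * (real s * \<delta>)\<^sup>2 / (\<Sum>j<s. (b - a)\<^sup>2) = - 2 * real s * \<delta>\<^sup>2 / (b - a)\<^sup>2"
    using \<open>s > 0\<close> \<open>a < b\<close> by (simp add: power2_eq_square)
  finally show ?thesis by (simp only: iid_def)
qed

lemma exists_pmf_label_dist: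
  assumes "p \<in> label_dist k"
  shows "\<exists>P :: nat pmf. \<forall>i. pmf P i = p i"
proof -
  have "(\<integral>\<^sup>+ i. ennreal (p i) \<partial>count_space UNIV) = (\<Sum>i<k. ennreal (p i))"
    by (rule nn_integral_count_space')
      (use label_dist_zero[OF assms] label_dist_nonneg[OF assms] in \<open>auto simp: not_less[symmetric]\<close>)
  also have "\<dots> = 1"
    using label_dist_sum[OF assms] by (simp add: sum_ennreal label_dist_nonneg[OF assms])
  finally have "pmf (embed_pmf p) i = p i" for i
    using label_dist_nonneg[OF assms] by (intro pmf_embed_pmf) auto
  then show ?thesis by blast
qed

text \<open>Markov's inequality for the number of bad vertices, whose expectation is at most
  \<open>q * card V\<close> by linearity. No independence between vertices is involved.\<close>

lemma prob_card_bad: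
  fixes p :: "'b pmf" and V :: "'a set"
  assumes V: "finite V" "V \<noteq> {}" and bad: "\<And>v. v \<in> V \<Longrightarrow> measure_pmf.prob p {X. bad X v} \<le> q"
    and "\<beta> > 0"
  shows "measure_pmf.prob p {X. \<beta> * real (card V) \<le> real (card {v \<in> V. bad X v})} \<le> q / \<beta>"
proof -
  let ?N = "\<lambda>X. real (card {v \<in> V. bad X v})"
  have N: "?N X = (\<Sum>v\<in>V. indicator {X. bad X v} X)" for X
    using V by (simp add: indicator_def sum.If_cases Int_def)
  have "card V > 0" using V by (simp add: card_gt_0_iff)
  have "measure_pmf.prob p {X\<in>space (measure_pmf p). \<beta> * real (card V) \<le> ?N X} \<le>
      measure_pmf.expectation p ?N / (\<beta> * real (card V))"
  proof (rule integral_Markov_inequality_measure[where A = UNIV])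
    show "integrable (measure_pmf p) ?N"
      unfolding N by (intro Bochner_Integration.integrable_sum integrable_real_indicator)
        (auto simp: measure_pmf.emeasure_eq_measure)
  qed (use \<open>card V > 0\<close> \<open>\<beta> > 0\<close> in auto)
  also have "measure_pmf.expectation p ?N = (\<Sum>v\<in>V. measure_pmf.prob p {X. bad X v})"
    unfolding N
    by (subst Bochner_Integration.integral_sum)
       (auto intro!: integrable_real_indicator simp: measure_pmf.emeasure_eq_measure)
  also have "\<dots> \<le> real (card V) * q"
    using bad by (intro sum_bounded_above) auto
  finally show ?thesis
    using \<open>card V > 0\<close> \<open>\<beta> > 0\<close> by (simp add: divide_right_mono field_simps)
qed

definition sampled_pull ::
    "('a \<Rightarrow> 'a \<Rightarrow> bool) \<Rightarrow> nat \<Rightarrow> (nat \<Rightarrow> 'a) \<Rightarrow> (nat \<Rightarrow> nat) \<Rightarrow> 'a \<Rightarrow> nat \<Rightarrow> real" where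
  "sampled_pull E s U l v i = (\<Sum>j<s. edge_sign E (U j) v * of_bool (l j = i)) / real s"

definition labellings :: "nat \<Rightarrow> nat \<Rightarrow> (nat \<Rightarrow> nat) set" where
  "labellings s k = {..<s} \<rightarrow>\<^sub>E {..<k}"

text \<open>Drawing the label of each sampled vertex \<open>u\<close> from the distribution \<open>x u\<close> shows that some
  labelling of a random sample reproduces the pulls of \<open>x\<close>.\<close>

lemma prob_good_labelling:
  fixes V :: "'a set" and x :: "'a \<Rightarrow> nat \<Rightarrow> real"
  assumes V: "finite V" "V \<noteq> {}" and x: "\<And>v. x v \<in> label_dist k"
    and "s > 0" "\<delta> > 0" "\<beta> > 0"
  shows "measure_pmf.prob (iid s d (pmf_of_set V))
     {U. \<exists>l\<in>labellings s k. real (card {v \<in> V. \<exists>i<k.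
         \<delta> \<le> \<bar>sampled_pull E s U l v i - pull V E x v i / real (card V)\<bar>}) < \<beta> * real (card V)}
    \<ge> 1 - 2 * real k * exp (- real s * \<delta>\<^sup>2 / 2) / \<beta>" (is "measure_pmf.prob _ {U. ?good U} \<ge> _")
proof -
  obtain P :: "'a \<Rightarrow> nat pmf" where P: "\<And>u i. pmf (P u) i = x u i"
    using exists_pmf_label_dist[OF x] by metis
  have set_P: "set_pmf (P u) \<subseteq> {..<k}" for u
  proof
    fix i assume "i \<in> set_pmf (P u)"
    then have "x u i \<noteq> 0" by (simp add: set_pmf_iff P)
    then show "i \<in> {..<k}" using label_dist_zero[OF x[of u], of i] by force
  qed
  then have fin_P: "finite (set_pmf (P u))" for u by (rule finite_subset) simp
  \<comment> \<open>\<open>J\<close> draws a uniform vertex \<open>u\<close> and then a label from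
    \<open>x u\<close>. The function \<open>h v i\<close> has mean
    \<open>pull V E x v i / card V\<close> under \<open>J\<close>, and its empirical mean is a
    sampled pull.\<close>
  define J where "J = pmf_of_set V \<bind> (\<lambda>u. map_pmf (Pair u) (P u))"
  have fst_J: "map_pmf fst J = pmf_of_set V"
    by (simp add: J_def map_bind_pmf pmf.map_comp o_def bind_return_pmf')
  have snd_J: "snd y < k" if "y \<in> set_pmf J" for y
    using that set_P by (fastforce simp: J_def)
  define h where "h v i y = edge_sign E (fst y) v * of_bool (snd y = i)" for v i and y :: "'a \<times> nat"
  have mean: "measure_pmf.expectation J (h v i) = pull V E x v i / real (card V)" for v i
  proof -
    have "measure_pmf.expectation (P u) (\<lambda>l. h v i (u, l)) = edge_sign E u v * x u i" for u
      by (subst integral_measure_pmf_real[of "{i}"]) (auto simp: h_def P)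
    then show ?thesis
      using V unfolding J_def
      by (subst pmf_expectation_bind_pmf_of_set)
         (auto simp: fin_P pull_def divide_inverse sum_distrib_left mult_ac)
  qed
  define bad where "bad X v \<longleftrightarrow> (\<exists>i<k. \<delta> \<le> \<bar>(\<Sum>j<s. h v i (X j)) / real s - pull V E x v i / real (card V)\<bar>)"
    for X v
  define Js where "Js = iid s (d, undefined) J"
  define q where "q = 2 * real k * exp (- real s * \<delta>\<^sup>2 / 2)"
  \<comment> \<open>For a fixed vertex: Hoeffding with values in \<open>[-1, 1]\<close> and a union
    bound over the \<open>k\<close> labels.\<close>
  have bad: "measure_pmf.prob Js {X. bad X v} \<le> q" for v
  proof -
    have "{X. bad X v} = (\<Union>i<k. {X. \<delta> \<le> \<bar>(\<Sum>j<s. h v i (X j)) / real s - pull V E x v i / real (card V)\<bar>})"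
      by (auto simp: bad_def)
    also have "measure_pmf.prob Js \<dots> \<le>
        (\<Sum>i<k. measure_pmf.prob Js {X. \<delta> \<le> \<bar>(\<Sum>j<s. h v i (X j)) / real s - pull V E x v i / real (card V)\<bar>})"
      by (rule measure_pmf.finite_measure_subadditive_finite) auto
    also have "\<dots> \<le> real (card {..<k}) * (2 * exp (- 2 * real s * \<delta>\<^sup>2 / (1 - (- 1))\<^sup>2))"
    proof (rule sum_bounded_above)
      fix i
      show "measure_pmf.prob Js {X. \<delta> \<le> \<bar>(\<Sum>j<s. h v i (X j)) / real s - pull V E x v i / real (card V)\<bar>}
          \<le> 2 * exp (- 2 * real s * \<delta>\<^sup>2 / (1 - (- 1))\<^sup>2)"
        unfolding mean[symmetric] Js_def using \<open>s > 0\<close> \<open>\<delta> > 0\<close>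
        by (intro iid_Hoeffding) (auto simp: h_def edge_sign_def)
    qed
    also have "\<dots> = q" by (simp add: q_def)
    finally show ?thesis .
  qed
  let ?B = "{X. \<beta> * real (card V) \<le> real (card {v \<in> V. bad X v})}"
  have "measure_pmf.prob Js ?B \<le> q / \<beta>"
    by (rule prob_card_bad[OF V bad \<open>\<beta> > 0\<close>])
  moreover have "measure_pmf.prob Js (- ?B) = 1 - measure_pmf.prob Js ?B"
    using measure_pmf.prob_compl[of ?B Js] by (simp add: Compl_eq_Diff_UNIV)
  ultimately have "1 - q / \<beta> \<le> measure_pmf.prob Js (- ?B)" by simp
  \<comment> \<open>On the support all drawn labels are below \<open>k\<close>, so the drawn labels
    themselves are a witness in \<open>labellings s k\<close>. Forgetting the labels then leaves a
    uniform vertex sample.\<close>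
  also have "\<dots> = measure_pmf.prob Js (- ?B \<inter> set_pmf Js)" by (simp add: measure_Int_set_pmf)
  also have "\<dots> \<le> measure_pmf.prob Js {X. ?good (fst \<circ> X)}"
  proof (rule measure_pmf.finite_measure_mono)
    show "- ?B \<inter> set_pmf Js \<subseteq> {X. ?good (fst \<circ> X)}"
    proof
      fix X assume X: "X \<in> - ?B \<inter> set_pmf Js"
      have "X \<in> PiE_dflt {..<s} (d, undefined) (\<lambda>_. set_pmf J)"
        using X by (simp add: Js_def iid_def set_Pi_pmf o_def)
      then have XJ: "X j \<in> set_pmf J" if "j < s" for j using that by (auto simp: PiE_dflt_def)
      define l where "l = (\<lambda>j\<in>{..<s}. snd (X j))"
      have "l \<in> labellings s k" using XJ snd_J by (auto simp: l_def labellings_def)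
      moreover have "sampled_pull E s (fst \<circ> X) l v i = (\<Sum>j<s. h v i (X j)) / real s" for v i
        by (simp add: sampled_pull_def h_def l_def)
      ultimately show "X \<in> {X. ?good (fst \<circ> X)}"
        using X by (intro CollectI bexI[of _ l]) (auto simp: bad_def not_le)
    qed
  qed auto
  also have "\<dots> = measure_pmf.prob (map_pmf (\<lambda>X. fst \<circ> X) Js) {U. ?good U}"
    by (simp add: vimage_def)
  also have "map_pmf (\<lambda>X. fst \<circ> X) Js = iid s d (pmf_of_set V)"
    unfolding Js_def iid_def fst_J[symmetric]
    by (rule Pi_pmf_map[symmetric]) auto
  finally show ?thesis by (simp add: q_def)
qed

section \<open>Testing candidates on random vertex pairs\<close>

definition sampled_cost ::
    "('a \<Rightarrow> 'a \<Rightarrow> bool) \<Rightarrow> nat \<Rightarrow> nat \<Rightarrow> (nat \<Rightarrow> 'a \<times> 'a) \<Rightarrow> ('a \<Rightarrow> nat \<Rightarrow> real) \<Rightarrow> real" where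
  "sampled_cost E k t W x = (\<Sum>m<t. pair_cost E k x (fst (W m)) (snd (W m))) / (2 * real t)"

text \<open>Hoeffding for each member of \<open>L\<close>, followed by a union bound. Because of the
  halving in \<open>sampled_cost\<close>, an error \<open>\<rho>\<close> means an error
  \<open>2 * \<rho>\<close> in the average pair cost, and \<open>2 * (2 * \<rho>)\<^sup>2\<close>
  gives the 8 in the exponent.\<close>

lemma prob_sampled_cost:
  fixes V :: "'a set"
  assumes V: "finite V" "V \<noteq> {}" and L: "finite L" and x: "\<And>l v. l \<in> L \<Longrightarrow> x l v \<in> label_dist k"
    and "t > 0" "\<rho> \<ge> 0"
  shows "measure_pmf.prob (iid t d (pmf_of_set (V \<times> V)))
     {W. \<exists>l\<in>L. \<rho> \<le> \<bar>sampled_cost E k t W (x l) - total_cost V E k (x l) / (2 * real (card V) ^ 2)\<bar>}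
    \<le> 2 * real (card L) * exp (- 8 * real t * \<rho>\<^sup>2)"
proof -
  let ?M = "iid t d (pmf_of_set (V \<times> V))"
  let ?B = "\<lambda>l. {W. \<rho> \<le> \<bar>sampled_cost E k t W (x l) - total_cost V E k (x l) / (2 * real (card V) ^ 2)\<bar>}"
  have "measure_pmf.prob ?M (?B l) \<le> 2 * exp (- 8 * real t * \<rho>\<^sup>2)" if "l \<in> L" for l
  proof -
    define h where "h y = pair_cost E k (x l) (fst y) (snd y)" for y
    have "measure_pmf.expectation (pmf_of_set (V \<times> V)) h = sum h (V \<times> V) / real (card (V \<times> V))"
      by (rule integral_pmf_of_set) (use V in auto)
    also have "\<dots> = total_cost V E k (x l) / real (card V) ^ 2"
      by (simp add: total_cost_def h_def sum.cartesian_product' card_cartesian_product power2_eq_square)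
    finally have mean: "measure_pmf.expectation (pmf_of_set (V \<times> V)) h = total_cost V E k (x l) / real (card V) ^ 2" .
    have "sampled_cost E k t W (x l) - total_cost V E k (x l) / (2 * real (card V) ^ 2) =
        ((\<Sum>m<t. h (W m)) / real t - total_cost V E k (x l) / real (card V) ^ 2) / 2" for W
      by (simp add: sampled_cost_def h_def field_simps)
    then have "?B l = {W. 2 * \<rho> \<le> \<bar>(\<Sum>m<t. h (W m)) / real t - measure_pmf.expectation (pmf_of_set (V \<times> V)) h\<bar>}"
      unfolding mean by (simp only: abs_divide) (auto simp: pos_le_divide_eq mult.commute)
    also have "measure_pmf.prob ?M \<dots> \<le> 2 * exp (- 2 * real t * (2 * \<rho>)\<^sup>2 / (1 - 0)\<^sup>2)"
      using \<open>t > 0\<close> \<open>\<rho> \<ge> 0\<close> pair_cost_bounds[OF x[OF that]]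
      by (intro iid_Hoeffding) (auto simp: h_def)
    finally show ?thesis by (simp add: power_mult_distrib mult.assoc)
  qed
  then have "(\<Sum>l\<in>L. measure_pmf.prob ?M (?B l)) \<le> real (card L) * (2 * exp (- 8 * real t * \<rho>\<^sup>2))"
    by (intro sum_bounded_above) auto
  moreover have "measure_pmf.prob ?M (\<Union>l\<in>L. ?B l) \<le> (\<Sum>l\<in>L. measure_pmf.prob ?M (?B l))"
    by (rule measure_pmf.finite_measure_subadditive_finite) (use L in auto)
  moreover have "(\<Union>l\<in>L. ?B l) =
    {W. \<exists>l\<in>L. \<rho> \<le> \<bar>sampled_cost E k t W (x l) - total_cost V E k (x l) / (2 * real (card V) ^ 2)\<bar>}"
    by auto
  ultimately show ?thesis by simp
qed

text \<open>Conditioning on the first component. It serves to treat the candidates as fixed: they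
  depend on the vertex sample, but the test pairs are drawn independently of it.\<close>

lemma prob_pair_pmf_le:
  assumes "\<And>u. measure_pmf.prob q {w. B u w} \<le> c"
  shows "measure_pmf.prob (pair_pmf p q) {y. B (fst y) (snd y)} \<le> c"
proof -
  have "c \<ge> 0" using assms measure_nonneg order_trans by blast
  have "pair_pmf p q = p \<bind> (\<lambda>u. map_pmf (Pair u) q)"
    by (simp add: pair_pmf_def map_pmf_def)
  then have "emeasure (pair_pmf p q) {y. B (fst y) (snd y)} = (\<integral>\<^sup>+u. emeasure q {w. B u w} \<partial>p)"
    by (simp add: vimage_def)
  also have "\<dots> \<le> (\<integral>\<^sup>+u. ennreal c \<partial>p)"
    by (intro nn_integral_mono) (simp add: measure_pmf.emeasure_eq_measure assms ennreal_leI)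
  also have "\<dots> = ennreal c" by simp
  finally show ?thesis
    using \<open>c \<ge> 0\<close> by (simp add: measure_pmf.emeasure_eq_measure)
qed

section \<open>Candidates and the estimator\<close>

definition candidate ::
    "('a \<Rightarrow> 'a \<Rightarrow> bool) \<Rightarrow> nat \<Rightarrow> nat \<Rightarrow> real \<Rightarrow> (nat \<Rightarrow> 'a) \<Rightarrow> (nat \<Rightarrow> nat) \<Rightarrow> 'a \<Rightarrow> nat \<Rightarrow> real" where
  "candidate E k s lam U l v = softmax k (\<lambda>i. sampled_pull E s U l v i / lam)"

definition estimate ::
    "('a \<Rightarrow> 'a \<Rightarrow> bool) \<Rightarrow> nat \<Rightarrow> nat \<Rightarrow> nat \<Rightarrow> real \<Rightarrow> (nat \<Rightarrow> 'a) \<Rightarrow> (nat \<Rightarrow> 'a \<times> 'a) \<Rightarrow> real" where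
  "estimate E k s t lam U W =
     Min ((\<lambda>l. sampled_cost E k t W (candidate E k s lam U l)) ` labellings s k)"

lemma labellings_finite: "finite (labellings s k)"
  by (simp add: labellings_def finite_PiE)

lemma labellings_nonempty: "k > 0 \<Longrightarrow> labellings s k \<noteq> {}"
  by (auto simp: labellings_def PiE_eq_empty_iff)

lemma card_labellings: "card (labellings s k) = k ^ s"
  by (simp add: labellings_def card_PiE)

text \<open>Off the exceptional set the energies differ by at most \<open>\<delta> / lam\<close>, so
  the softmax values agree up to the factor \<open>exp (2 * \<delta> / lam)\<close>. Its square
  enters the cost, and normalising by twice the squared number of vertices halves the resulting
  error. The exceptional vertices contribute \<open>\<beta>\<close>.\<close>

lemma candidate_cost:
  assumes V: "finite V" "V \<noteq> {}" and "k > 0" "lam > 0" "\<delta> > 0"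
    and x: "\<And>v. x v \<in> label_dist k" "\<And>v. v \<in> V \<Longrightarrow> x v = softmax k (\<lambda>i. pull V E x v i / (real (card V) * lam))"
    and few: "real (card {v \<in> V. \<exists>i<k.
         \<delta> \<le> \<bar>sampled_pull E s U l v i - pull V E x v i / real (card V)\<bar>}) \<le> \<beta> * real (card V)"
      (is "real (card ?B) \<le> _")
  shows "total_cost V E k (candidate E k s lam U l) / (2 * real (card V) ^ 2) \<le>
    total_cost V E k x / (2 * real (card V) ^ 2) + (exp (4 * \<delta> / lam) - 1) / 2 + \<beta>"
proof -
  let ?n = "real (card V)"
  let ?a = "exp (2 * (\<delta> / lam))"
  have n: "?n > 0" using V by (simp add: card_gt_0_iff)
  have "total_cost V E k (candidate E k s lam U l) \<le>
      total_cost V E k x + ?n ^ 2 * (?a\<^sup>2 - 1) + 2 * ?n * real (card ?B)"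
  proof (rule total_cost_perturb)
    fix v i assume v: "v \<in> V - ?B"
    have near: "\<bar>sampled_pull E s U l v j / lam - pull V E x v j / (?n * lam)\<bar> \<le> \<delta> / lam" if "j < k" for j
    proof -
      have "\<bar>sampled_pull E s U l v j - pull V E x v j / ?n\<bar> \<le> \<delta>"
        using v that by (auto simp: not_le less_imp_le)
      moreover have "sampled_pull E s U l v j / lam - pull V E x v j / (?n * lam) =
          (sampled_pull E s U l v j - pull V E x v j / ?n) / lam"
        by (simp add: diff_divide_distrib)
      ultimately show ?thesis using \<open>lam > 0\<close> by (simp add: divide_right_mono)
    qed
    then have near': "\<bar>pull V E x v j / (?n * lam) - sampled_pull E s U l v j / lam\<bar> \<le> \<delta> / lam" if "j < k" for j
      using that by (simp add: abs_minus_commute)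
    have "x v = softmax k (\<lambda>i. pull V E x v i / (?n * lam))" using x(2) v by blast
    then show "x v i \<le> ?a * candidate E k s lam U l v i \<and> candidate E k s lam U l v i \<le> ?a * x v i"
      using softmax_perturb[of k _ _ "\<delta> / lam" i, OF near] softmax_perturb[of k _ _ "\<delta> / lam" i, OF near']
      by (simp only: candidate_def)
  qed (use V x \<open>lam > 0\<close> \<open>\<delta> > 0\<close> in \<open>auto simp: candidate_def softmax_label_dist[OF \<open>k > 0\<close>]\<close>)
  also have "?a\<^sup>2 = exp (4 * \<delta> / lam)" by (simp flip: exp_double)
  also have "2 * ?n * real (card ?B) \<le> 2 * ?n * (\<beta> * ?n)"
    using few n by (intro mult_left_mono) auto
  finally have "total_cost V E k (candidate E k s lam U l) / (2 * ?n ^ 2) \<le>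
      (total_cost V E k x + ?n ^ 2 * (exp (4 * \<delta> / lam) - 1) + 2 * ?n * (\<beta> * ?n)) / (2 * ?n ^ 2)"
    by (intro divide_right_mono) auto
  also have "\<dots> = total_cost V E k x / (2 * ?n ^ 2) + (exp (4 * \<delta> / lam) - 1) / 2 + \<beta>"
    using n by (simp add: add_divide_distrib power2_eq_square)
  finally show ?thesis .
qed

text \<open>Rounding turns every fractional clustering into a genuine one that is no more expensive.
  Hence labellings that fit the sample badly do no harm: apart from the testing error, the minimum
  over all labellings cannot fall below the distance.\<close>

lemma dist_le_total_cost:
  assumes "simple_graph G" "\<And>v. x v \<in> label_dist k"
  shows "dist_to_property G (induced_free P3) \<le>
    total_cost (verts G) (adjacent G) k x / (2 * real (card (verts G)) ^ 2)"
proof -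
  obtain \<phi> where \<phi>: "disagreements (verts G) (adjacent G) \<phi> \<le> total_cost (verts G) (adjacent G) k x"
    using rounding[of "verts G" "adjacent G" x k] assms adjacent_sym[of G] by (auto simp: simple_graph_def)
  have "dist_to_property G (induced_free P3) \<le>
      disagreements (verts G) (adjacent G) \<phi> / (2 * real (card (verts G)) ^ 2)"
    by (rule dist_P3_free_le[OF assms(1)])
  also have "\<dots> \<le> total_cost (verts G) (adjacent G) k x / (2 * real (card (verts G)) ^ 2)"
    by (rule divide_right_mono[OF \<phi>]) simp
  finally show ?thesis .
qed

text \<open>The four error terms come from merging into \<open>k\<close> clusters, from the entropy
  regularisation, from the sampling error in the pulls, and from the vertices whose pulls are
  estimated badly.\<close>

lemma prob_good_candidate:
  fixes G :: "nat graph"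
  assumes G: "simple_graph G" and ne: "verts G \<noteq> {}"
    and "k > 0" "s > 0" "lam > 0" "\<delta> > 0" "\<beta> > 0"
  shows "measure_pmf.prob (iid s d (pmf_of_set (verts G)))
     {U. \<exists>l\<in>labellings s k. total_cost (verts G) (adjacent G) k (candidate (adjacent G) k s lam U l) /
           (2 * real (card (verts G)) ^ 2) \<le> dist_to_property G (induced_free P3) +
           (1 / (2 * real k) + lam * real k + (exp (4 * \<delta> / lam) - 1) / 2 + \<beta>)}
    \<ge> 1 - 2 * real k * exp (- real s * \<delta>\<^sup>2 / 2) / \<beta>"
proof -
  define V where "V = verts G"
  define E where "E = adjacent G"
  define n where "n = real (card V)"
  have V: "finite V" "V \<noteq> {}" using G ne by (auto simp: V_def simple_graph_def)
  have n: "n > 0" using V by (simp add: n_def card_gt_0_iff)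
  have E: "symp E" by (simp add: E_def adjacent_sym)
  obtain \<phi> where \<phi>: "dist_to_property G (induced_free P3) = disagreements V E \<phi> / (2 * n ^ 2)"
    using dist_P3_free_attained[OF G] by (auto simp: V_def E_def n_def)
  obtain \<psi> where \<psi>: "\<forall>v. \<psi> v < k" "disagreements V E \<psi> \<le> disagreements V E \<phi> + n ^ 2 / real k"
    using few_clusters[OF V(1) \<open>k > 0\<close>, of E \<phi>] by (auto simp: n_def)
  \<comment> \<open>The entropy weight \<open>2 * (n * lam)\<close> makes the energy at the fixed
    point the average pull divided by \<open>lam\<close>, the quantity that \<open>candidate\<close>
    estimates.\<close>
  obtain x where x: "\<forall>v. x v \<in> label_dist k"
      "\<forall>v\<in>V. x v = softmax k (\<lambda>i. 2 * pull V E x v i / (2 * (n * lam)))"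
    and x_le: "\<forall>y. (\<forall>v. y v \<in> label_dist k) \<longrightarrow>
      total_cost V E k x \<le> total_cost V E k y + 2 * (n * lam) * n * real k"
    using exists_softmax_fixpoint[OF V(1) E \<open>k > 0\<close>, of "2 * (n * lam)"] n \<open>lam > 0\<close>
    unfolding n_def by auto
  have "total_cost V E k x \<le> total_cost V E k (\<lambda>v. one_hot (\<psi> v)) + 2 * (n * lam) * n * real k"
    using x_le \<psi>(1) one_hot_label_dist by simp
  also have "total_cost V E k (\<lambda>v. one_hot (\<psi> v)) = disagreements V E \<psi>"
    using \<psi>(1) by (intro total_cost_one_hot) auto
  finally have "total_cost V E k x \<le> disagreements V E \<phi> + n ^ 2 / real k + 2 * (n * lam) * n * real k"
    using \<psi>(2) by linarith
  then have "total_cost V E k x / (2 * n ^ 2) \<le>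
      (disagreements V E \<phi> + n ^ 2 / real k + 2 * (n * lam) * n * real k) / (2 * n ^ 2)"
    by (intro divide_right_mono) auto
  also have "\<dots> = disagreements V E \<phi> / (2 * n ^ 2) + 1 / (2 * real k) + lam * real k"
    using n \<open>k > 0\<close> by (simp add: add_divide_distrib power2_eq_square)
  finally have cost_x: "total_cost V E k x / (2 * n ^ 2) \<le>
      dist_to_property G (induced_free P3) + 1 / (2 * real k) + lam * real k"
    unfolding \<phi> .
  have "1 - 2 * real k * exp (- real s * \<delta>\<^sup>2 / 2) / \<beta> \<le> measure_pmf.prob (iid s d (pmf_of_set V))
     {U. \<exists>l\<in>labellings s k. real (card {v \<in> V. \<exists>i<k.
         \<delta> \<le> \<bar>sampled_pull E s U l v i - pull V E x v i / real (card V)\<bar>}) < \<beta> * real (card V)}"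
    by (rule prob_good_labelling) (use V x assms in auto)
  also have "\<dots> \<le> measure_pmf.prob (iid s d (pmf_of_set V))
     {U. \<exists>l\<in>labellings s k. total_cost V E k (candidate E k s lam U l) /
           (2 * n ^ 2) \<le> dist_to_property G (induced_free P3) +
           (1 / (2 * real k) + lam * real k + (exp (4 * \<delta> / lam) - 1) / 2 + \<beta>)}"
  proof (rule measure_pmf.finite_measure_mono, rule subsetI)
    fix U assume "U \<in> {U. \<exists>l\<in>labellings s k. real (card {v \<in> V. \<exists>i<k.
         \<delta> \<le> \<bar>sampled_pull E s U l v i - pull V E x v i / real (card V)\<bar>}) < \<beta> * real (card V)}"
    then obtain l where l: "l \<in> labellings s k" "real (card {v \<in> V. \<exists>i<k.
         \<delta> \<le> \<bar>sampled_pull E s U l v i - pull V E x v i / real (card V)\<bar>}) \<le> \<beta> * real (card V)"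
      using less_imp_le by blast
    have "total_cost V E k (candidate E k s lam U l) / (2 * real (card V) ^ 2) \<le>
        total_cost V E k x / (2 * real (card V) ^ 2) + (exp (4 * \<delta> / lam) - 1) / 2 + \<beta>"
      by (rule candidate_cost[OF V \<open>k > 0\<close> \<open>lam > 0\<close> \<open>\<delta> > 0\<close> _ _ l(2)]) (use x in \<open>auto simp: n_def\<close>)
    then show "U \<in> {U. \<exists>l\<in>labellings s k. total_cost V E k (candidate E k s lam U l) /
           (2 * n ^ 2) \<le> dist_to_property G (induced_free P3) +
           (1 / (2 * real k) + lam * real k + (exp (4 * \<delta> / lam) - 1) / 2 + \<beta>)}"
      using cost_x l(1) by (intro CollectI bexI[of _ l]) (simp_all add: n_def)
  qed simp
  finally show ?thesis unfolding V_def E_def n_def .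
qed

text \<open>Two events of probability at most 1/6 are excluded: that no labelling yields a good
  candidate, and that some candidate is misjudged by the test pairs. Otherwise the good candidate
  bounds the minimum from above and \<open>dist_le_total_cost\<close> bounds it from below.\<close>

lemma prob_estimate:
  fixes G :: "nat graph"
  assumes G: "simple_graph G" and ne: "verts G \<noteq> {}"
    and pos: "k > 0" "s > 0" "t > 0" "lam > 0" "\<delta> > 0" "\<beta> > 0" "\<rho> > 0"
    and err: "1 / (2 * real k) + lam * real k + (exp (4 * \<delta> / lam) - 1) / 2 + \<beta> + \<rho> \<le> e"
    and fail1: "2 * real k * exp (- real s * \<delta>\<^sup>2 / 2) / \<beta> \<le> 1 / 6"
    and fail2: "2 * real k ^ s * exp (- 8 * real t * \<rho>\<^sup>2) \<le> 1 / 6"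
  shows "measure_pmf.prob (pair_pmf (iid s 0 (pmf_of_set (verts G))) (iid t (0, 0) (pmf_of_set (verts G \<times> verts G))))
      {y. \<bar>estimate (adjacent G) k s t lam (fst y) (snd y) - dist_to_property G (induced_free P3)\<bar> \<le> e} \<ge> 2 / 3"
proof -
  define V where "V = verts G"
  define E where "E = adjacent G"
  define D where "D = dist_to_property G (induced_free P3)"
  define \<eta> where "\<eta> = 1 / (2 * real k) + lam * real k + (exp (4 * \<delta> / lam) - 1) / 2 + \<beta>"
  define f where "f U l = total_cost V E k (candidate E k s lam U l) / (2 * real (card V) ^ 2)" for U l
  define g where "g U W l = sampled_cost E k t W (candidate E k s lam U l)" for U W l
  define good where "good U \<longleftrightarrow> (\<exists>l\<in>labellings s k. f U l \<le> D + \<eta>)" for U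
  define bad where "bad U W \<longleftrightarrow> (\<exists>l\<in>labellings s k. \<rho> \<le> \<bar>g U W l - f U l\<bar>)" for U W
  let ?PU = "iid s 0 (pmf_of_set V)"
  let ?PW = "iid t (0, 0) (pmf_of_set (V \<times> V))"
  have V: "finite V" "V \<noteq> {}" using G ne by (auto simp: V_def simple_graph_def)
  have cand: "candidate E k s lam U l v \<in> label_dist k" for U l v
    unfolding candidate_def by (rule softmax_label_dist[OF \<open>k > 0\<close>])
  have "measure_pmf.prob ?PU {U. good U} \<ge> 5 / 6"
    using prob_good_candidate[OF G ne pos(1,2,4,5,6), of 0] fail1
    by (simp add: good_def f_def D_def \<eta>_def V_def E_def)
  then have "measure_pmf.prob (map_pmf fst (pair_pmf ?PU ?PW)) {U. good U} \<ge> 5 / 6"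
    by (simp only: map_fst_pair_pmf)
  then have 1: "measure_pmf.prob (pair_pmf ?PU ?PW) {y. good (fst y)} \<ge> 5 / 6"
    by (simp add: vimage_def)
  have 2: "measure_pmf.prob (pair_pmf ?PU ?PW) {y. bad (fst y) (snd y)} \<le> 1 / 6"
  proof (rule prob_pair_pmf_le)
    fix U
    have "measure_pmf.prob ?PW {W. bad U W} \<le> 2 * real (card (labellings s k)) * exp (- 8 * real t * \<rho>\<^sup>2)"
      unfolding bad_def f_def g_def
      by (rule prob_sampled_cost) (use V labellings_finite cand pos in auto)
    then show "measure_pmf.prob ?PW {W. bad U W} \<le> 1 / 6"
      using fail2 by (simp add: card_labellings)
  qed
  have "{y. good (fst y)} - {y. bad (fst y) (snd y)} \<subseteq> {y. \<bar>estimate E k s t lam (fst y) (snd y) - D\<bar> \<le> e}"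
  proof
    fix y assume y: "y \<in> {y. good (fst y)} - {y. bad (fst y) (snd y)}"
    let ?L = "labellings s k" and ?g = "g (fst y) (snd y)" and ?f = "f (fst y)"
    have est: "estimate E k s t lam (fst y) (snd y) = Min (?g ` ?L)"
      by (simp add: estimate_def g_def)
    have acc: "\<bar>?g l - ?f l\<bar> < \<rho>" if "l \<in> ?L" for l
      using y that by (auto simp: bad_def not_le)
    obtain l where l: "l \<in> ?L" "?f l \<le> D + \<eta>" using y by (auto simp: good_def)
    have "Min (?g ` ?L) \<le> ?g l" using l labellings_finite by (intro Min_le) auto
    then have upper: "Min (?g ` ?L) \<le> D + e" using acc[OF l(1)] l(2) err by (simp add: \<eta>_def)
    have "Min (?g ` ?L) \<in> ?g ` ?L"
      using labellings_finite labellings_nonempty[OF \<open>k > 0\<close>] by (intro Min_in) auto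
    then obtain m where m: "m \<in> ?L" "Min (?g ` ?L) = ?g m" by auto
    have "D \<le> ?f m"
      unfolding D_def f_def V_def E_def by (rule dist_le_total_cost[OF G]) (use cand in \<open>simp add: E_def\<close>)
    moreover have "0 \<le> \<eta>" unfolding \<eta>_def using pos by simp
    then have "\<rho> \<le> e" using err by (simp add: \<eta>_def)
    ultimately have "D - e \<le> Min (?g ` ?L)" using acc[OF m(1)] m(2) by linarith
    with upper show "y \<in> {y. \<bar>estimate E k s t lam (fst y) (snd y) - D\<bar> \<le> e}"
      by (simp add: est abs_le_iff)
  qed
  then have "measure_pmf.prob (pair_pmf ?PU ?PW) ({y. good (fst y)} - {y. bad (fst y) (snd y)}) \<le>
      measure_pmf.prob (pair_pmf ?PU ?PW) {y. \<bar>estimate E k s t lam (fst y) (snd y) - D\<bar> \<le> e}"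
    by (intro measure_pmf.finite_measure_mono) auto
  moreover have "measure_pmf.prob (pair_pmf ?PU ?PW) {y. good (fst y)} \<le>
      measure_pmf.prob (pair_pmf ?PU ?PW) ({y. good (fst y)} - {y. bad (fst y) (snd y)}) +
      measure_pmf.prob (pair_pmf ?PU ?PW) {y. bad (fst y) (snd y)}"
    by (rule order_trans[OF measure_pmf.finite_measure_mono measure_Un_le]) auto
  ultimately show ?thesis using 1 2 by (simp add: V_def E_def D_def)
qed

section \<open>The algorithm\<close>

text \<open>A non-adaptive algorithm in decision-tree form: \<open>Q\<close> accumulates the pairs
  answered positively, and all further computation sits in \<open>F\<close> at the leaves.\<close>

primrec query_all :: "(nat \<times> nat) list \<Rightarrow> (nat \<times> nat) set \<Rightarrow> ((nat \<times> nat) set \<Rightarrow> real) \<Rightarrow> query_tree" where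
  "query_all [] Q F = Output (F Q)"
| "query_all (p # ps) Q F =
     Query (fst p) (snd p) (query_all ps (insert p Q) F) (query_all ps Q F)"

lemma run_query_all:
  "run (query_all ps Q F) G = F (Q \<union> {p \<in> set ps. adjacent G (fst p) (snd p)})"
proof (induction ps arbitrary: Q)
  case (Cons p ps)
  show ?case
    by (simp add: Cons.IH) (auto intro!: arg_cong[where f = F])
qed simp

lemma num_queries_query_all: "num_queries (query_all ps Q F) G = length ps"
  by (induction ps arbitrary: Q) auto

definition sample_points :: "nat \<Rightarrow> nat \<Rightarrow> (nat \<Rightarrow> 'a) \<Rightarrow> (nat \<Rightarrow> 'a \<times> 'a) \<Rightarrow> 'a list" where
  "sample_points s t U W =
     map U [0..<s] @ map (\<lambda>m. fst (W m)) [0..<t] @ map (\<lambda>m. snd (W m)) [0..<t]"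

text \<open>Candidates are evaluated only at end points of test pairs, and there they use only edges
  to the sampled vertices. So the edges among the sample points determine the estimate for all
  labellings at once, and trying exponentially many labellings costs no further queries.\<close>

lemma estimate_cong:
  assumes "\<And>u v. u \<in> set (sample_points s t U W) \<Longrightarrow> v \<in> set (sample_points s t U W) \<Longrightarrow> E u v = E' u v"
  shows "estimate E k s t lam U W = estimate E' k s t lam U W"
proof -
  have U: "U j \<in> set (sample_points s t U W)" if "j < s" for j
    using that by (auto simp: sample_points_def)
  have W: "fst (W m) \<in> set (sample_points s t U W)" "snd (W m) \<in> set (sample_points s t U W)" if "m < t" for m
    using that by (auto simp: sample_points_def)
  have "candidate E k s lam U l v = candidate E' k s lam U l v" if "v \<in> set (sample_points s t U W)" for l v
    unfolding candidate_def sampled_pull_def edge_sign_def using assms[OF U that]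
    by (intro arg_cong2[where f = softmax] refl ext arg_cong2[where f = "(/)"] sum.cong) auto
  then have "sampled_cost E k t W (candidate E k s lam U l) = sampled_cost E' k t W (candidate E' k s lam U l)" for l
    unfolding sampled_cost_def pair_cost_def using assms W
    by (intro arg_cong2[where f = "(/)"] sum.cong refl) auto
  then show ?thesis by (simp only: estimate_def)
qed

definition query_sample ::
    "nat \<Rightarrow> nat \<Rightarrow> nat \<Rightarrow> real \<Rightarrow> (nat \<Rightarrow> nat) \<times> (nat \<Rightarrow> nat \<times> nat) \<Rightarrow> query_tree" where
  "query_sample k s t lam y =
     (let pts = sample_points s t (fst y) (snd y)
      in query_all (List.product pts pts) {}
           (\<lambda>Q. estimate (\<lambda>u v. (u, v) \<in> Q) k s t lam (fst y) (snd y)))"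

lemma run_query_sample:
  "run (query_sample k s t lam y) G = estimate (adjacent G) k s t lam (fst y) (snd y)"
  unfolding query_sample_def Let_def run_query_all by (rule estimate_cong) auto

lemma num_queries_query_sample:
  "num_queries (query_sample k s t lam y) G = (s + 2 * t)\<^sup>2"
  by (simp add: query_sample_def Let_def num_queries_query_all length_product sample_points_def power2_eq_square mult_2)

text \<open>With accuracy \<open>1/N\<close>, the pulls are needed up to \<open>\<delta> = 1/(256 N\<^sup>3)\<close> at all but a fraction
  \<open>1/(8N)\<close> of the vertices; \<open>25165824 = 2 \<cdot> 192 \<cdot> 256\<^sup>2\<close> makes the Hoeffding exponent
  \<open>s \<delta>\<^sup>2/2\<close> equal to \<open>192 N\<^sup>2\<close>, and the test size offsets the \<open>(2N)\<^sup>s\<close> labellings.\<close>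

definition sample_size :: "nat \<Rightarrow> nat" where
  "sample_size N = 25165824 * N ^ 8"

definition test_size :: "nat \<Rightarrow> nat" where
  "test_size N = 4 * N ^ 3 * sample_size N + 22 * N ^ 2"

text \<open>The empty graph is treated separately because there is no uniform distribution on the
  empty set.\<close>

definition cluster_distance_algorithm :: randomized_algorithm where
  "cluster_distance_algorithm n \<epsilon> =
     (if n = 0 then return_pmf (Output 0)
      else let N = nat \<lceil>1 / \<epsilon>\<rceil> in
        map_pmf (query_sample (2 * N) (sample_size N) (test_size N) (1 / (8 * real N ^ 2)))
          (pair_pmf (iid (sample_size N) 0 (pmf_of_set {..<n}))
             (iid (test_size N) (0, 0) (pmf_of_set ({..<n} \<times> {..<n})))))"

section \<open>Verification of the parameters\<close>

lemma accuracy_parameters: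
  assumes "N > 0"
  shows "1 / (2 * real (2 * N)) + 1 / (8 * real N ^ 2) * real (2 * N) +
      (exp (4 * (1 / (256 * real N ^ 3)) / (1 / (8 * real N ^ 2))) - 1) / 2 +
      1 / (8 * real N) + 1 / (4 * real N) \<le> 1 / real N"
proof -
  \<comment> \<open>In units of \<open>z\<close> the five errors are 2, 2, at most 1, 1 and 2, which
    add up to at most \<open>8 * z = 1 / N\<close>.\<close>
  define z where "z = 1 / (8 * real N)"
  have z: "0 \<le> z" "z \<le> 1" "1 / real N = 8 * z" using assms by (auto simp: z_def)
  have "4 * (1 / (256 * real N ^ 3)) / (1 / (8 * real N ^ 2)) = z"
    using assms by (simp add: z_def field_simps power2_eq_square power3_eq_cube)
  moreover have "exp z \<le> 1 + z + z\<^sup>2" using z by (intro exp_bound)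
  moreover have "z\<^sup>2 \<le> z" using z by (simp add: power2_eq_square mult_left_le)
  moreover have "1 / (2 * real (2 * N)) = 2 * z" "1 / (8 * real N ^ 2) * real (2 * N) = 2 * z"
    "1 / (4 * real N) = 2 * z"
    using assms by (simp_all add: z_def field_simps power2_eq_square)
  ultimately show ?thesis using z by (simp add: z_def[symmetric])
qed

lemma sample_size_failure:
  assumes "N > 0"
  shows "2 * real (2 * N) * exp (- real (sample_size N) * (1 / (256 * real N ^ 3))\<^sup>2 / 2) / (1 / (8 * real N)) \<le> 1 / 6"
proof -
  have N: "real N > 0" using assms by simp
  have "real (sample_size N) * (1 / (256 * real N ^ 3))\<^sup>2 / 2 = 192 * real N ^ 2"
    using N by (simp add: sample_size_def power_divide power_mult_distrib field_simps flip: power_add power_mult)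
  then have eq: "- real (sample_size N) * (1 / (256 * real N ^ 3))\<^sup>2 / 2 = - (192 * real N ^ 2)"
    by simp
  \<comment> \<open>The prefactor is \<open>32 * N ^ 2\<close>, a sixth of the exponent, so
    \<open>exp y \<ge> y\<close> suffices.\<close>
  have "192 * real N ^ 2 \<le> exp (192 * real N ^ 2)"
    using exp_ge_add_one_self[of "192 * real N ^ 2"] by linarith
  then have "exp (- (192 * real N ^ 2)) \<le> 1 / (192 * real N ^ 2)"
    using N by (simp add: exp_minus inverse_eq_divide frac_le)
  then have "32 * real N ^ 2 * exp (- (192 * real N ^ 2)) \<le> 32 * real N ^ 2 * (1 / (192 * real N ^ 2))"
    by (intro mult_left_mono) auto
  also have "\<dots> = 1 / 6" using N by simp
  finally show ?thesis unfolding eq by (simp add: power2_eq_square mult_ac)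
qed

lemma test_size_failure:
  assumes "N > 0"
  shows "2 * real (2 * N) ^ sample_size N * exp (- 8 * real (test_size N) * (1 / (4 * real N))\<^sup>2) \<le> 1 / 6"
proof -
  let ?s = "sample_size N"
  have N: "real N > 0" using assms by simp
  \<comment> \<open>The first part of the exponent absorbs the \<open>(2 * N) ^ s\<close>
    labellings, by \<open>2 * N \<le> exp (2 * N)\<close>. The remaining 11 gives
    \<open>exp (- 11) \<le> 1 / 12\<close>, which with the leading factor 2 makes 1/6.\<close>
  have "8 * real (test_size N) * (1 / (4 * real N))\<^sup>2 = 2 * real N * real ?s + 11"
    using N by (simp add: test_size_def power2_eq_square power3_eq_cube field_simps)
  then have eq: "- 8 * real (test_size N) * (1 / (4 * real N))\<^sup>2 = - (real ?s * (2 * real N)) + - 11"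
    by simp
  have "real (2 * N) \<le> exp (2 * real N)"
    using exp_ge_add_one_self[of "2 * real N"] unfolding of_nat_mult by linarith
  then have "real (2 * N) ^ ?s \<le> exp (2 * real N) ^ ?s" by (intro power_mono) auto
  also have "\<dots> = exp (real ?s * (2 * real N))" by (simp add: exp_of_nat_mult)
  finally have "real (2 * N) ^ ?s * exp (- (real ?s * (2 * real N))) \<le>
      exp (real ?s * (2 * real N)) * exp (- (real ?s * (2 * real N)))"
    by (intro mult_right_mono) auto
  also have "\<dots> = 1" by (simp flip: exp_add)
  finally have "real (2 * N) ^ ?s * exp (- (real ?s * (2 * real N))) \<le> 1" .
  moreover have "exp (- 11 :: real) \<le> 1 / 12"
    using exp_ge_add_one_self[of "11::real"] by (simp add: exp_minus inverse_eq_divide)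
  ultimately have "(real (2 * N) ^ ?s * exp (- (real ?s * (2 * real N)))) * exp (- 11) \<le> 1 * (1 / 12)"
    by (intro mult_mono) auto
  then show ?thesis unfolding eq exp_add by simp
qed

lemma distance_approximation_algorithm:
  "distance_approximation cluster_distance_algorithm (induced_free P3)"
  unfolding distance_approximation_def
proof (intro allI impI)
  fix n and \<epsilon> :: real and G :: "nat graph"
  assume "0 < \<epsilon> \<and> \<epsilon> < 1 \<and> simple_graph G \<and> verts G = {..<n}"
  then have \<epsilon>: "0 < \<epsilon>" "\<epsilon> < 1" and G: "simple_graph G" "verts G = {..<n}" by auto
  let ?D = "dist_to_property G (induced_free P3)"
  show "measure_pmf.prob (cluster_distance_algorithm n \<epsilon>) {T. \<bar>run T G - ?D\<bar> \<le> \<epsilon>} \<ge> 2 / 3"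
  proof (cases "n = 0")
    case True
    \<comment> \<open>For \<open>n = 0\<close> the distance is a quotient with denominator 0, which
      is 0 by convention.\<close>
    then have "?D = 0" using dist_P3_free_attained[OF G(1)] G(2) by auto
    then show ?thesis using True \<epsilon> by (simp add: cluster_distance_algorithm_def)
  next
    case False
    define N where "N = nat \<lceil>1 / \<epsilon>\<rceil>"
    have le: "1 / \<epsilon> \<le> real N" by (simp add: N_def real_nat_ceiling_ge)
    moreover have "1 / \<epsilon> > 0" using \<epsilon> by simp
    ultimately have "real N > 0" by linarith
    then have N: "N > 0" by simp
    have "1 / real N \<le> \<epsilon>" using le \<epsilon> \<open>real N > 0\<close> by (simp add: field_simps)
    let ?M = "pair_pmf (iid (sample_size N) 0 (pmf_of_set {..<n}))
             (iid (test_size N) (0, 0) (pmf_of_set ({..<n} \<times> {..<n})))"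
    have "2 / 3 \<le> measure_pmf.prob ?M {y. \<bar>estimate (adjacent G) (2 * N) (sample_size N) (test_size N)
        (1 / (8 * real N ^ 2)) (fst y) (snd y) - ?D\<bar> \<le> \<epsilon>}"
      unfolding G(2)[symmetric]
    proof (rule prob_estimate[where \<delta> = "1 / (256 * real N ^ 3)" and \<beta> = "1 / (8 * real N)" and \<rho> = "1 / (4 * real N)"])
      show "1 / (2 * real (2 * N)) + 1 / (8 * real N ^ 2) * real (2 * N) +
          (exp (4 * (1 / (256 * real N ^ 3)) / (1 / (8 * real N ^ 2))) - 1) / 2 +
          1 / (8 * real N) + 1 / (4 * real N) \<le> \<epsilon>"
        using accuracy_parameters[OF N] \<open>1 / real N \<le> \<epsilon>\<close> by linarith
    qed (use G N False sample_size_failure[OF N] test_size_failure[OF N] in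
         \<open>auto simp: sample_size_def test_size_def\<close>)
    also have "\<dots> = measure_pmf.prob (cluster_distance_algorithm n \<epsilon>) {T. \<bar>run T G - ?D\<bar> \<le> \<epsilon>}"
      using False by (simp add: cluster_distance_algorithm_def N_def[symmetric] vimage_def run_query_sample)
    finally show ?thesis .
  qed
qed

text \<open>This is \<open>(s + 2 * t)\<^sup>2\<close> for the sample and test sizes, with
  \<open>1 + y\<close> in place of \<open>N\<close>. It bounds the query count since
  \<open>N \<le> 1 + 1 / \<epsilon>\<close> and all coefficients are nonnegative.\<close>

definition query_bound :: "real poly" where
  "query_bound = ([:1, 1:] ^ 8 * [:25165824:] +
     2 * (4 * [:1, 1:] ^ 3 * ([:1, 1:] ^ 8 * [:25165824:]) + 22 * [:1, 1:] ^ 2)) ^ 2"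

lemma poly_query_bound:
  "poly query_bound y = (25165824 * (1 + y) ^ 8 +
     2 * (4 * (1 + y) ^ 3 * (25165824 * (1 + y) ^ 8) + 22 * (1 + y) ^ 2)) ^ 2"
  by (simp add: query_bound_def mult_ac)

lemma query_complexity_algorithm:
  "query_complexity_le cluster_distance_algorithm (\<lambda>\<epsilon>. poly query_bound (1 / \<epsilon>))"
  unfolding query_complexity_le_def
proof (intro allI impI ballI)
  fix n and \<epsilon> :: real and G :: "nat graph" and T
  assume *: "0 < \<epsilon> \<and> \<epsilon> < 1 \<and> simple_graph G \<and> verts G = {..<n}"
    and T: "T \<in> set_pmf (cluster_distance_algorithm n \<epsilon>)"
  show "real (num_queries T G) \<le> poly query_bound (1 / \<epsilon>)"
  proof (cases "n = 0")
    case True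
    then show ?thesis using T by (simp add: cluster_distance_algorithm_def poly_query_bound)
  next
    case False
    define N where "N = nat \<lceil>1 / \<epsilon>\<rceil>"
    have "1 / \<epsilon> > 0" using * by simp
    then have N: "real N \<le> 1 + 1 / \<epsilon>" unfolding N_def by linarith
    have "real (num_queries T G) = (real (sample_size N) + 2 * real (test_size N))\<^sup>2"
      using T False
      by (auto simp: cluster_distance_algorithm_def N_def[symmetric] Let_def num_queries_query_sample)
    also have "\<dots> = (25165824 * real N ^ 8 +
        2 * (4 * real N ^ 3 * (25165824 * real N ^ 8) + 22 * real N ^ 2)) ^ 2"
      by (simp add: sample_size_def test_size_def)
    also have "\<dots> \<le> poly query_bound (1 / \<epsilon>)"
      unfolding poly_query_bound using N \<open>1 / \<epsilon> > 0\<close>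
      by (intro power_mono add_mono mult_mono) auto
    finally show ?thesis .
  qed
qed

theorem theorem1p3:
  "\<exists>(A :: randomized_algorithm) (p :: real poly).
     distance_approximation A (induced_free P3) \<and>
     query_complexity_le A (\<lambda>\<epsilon>. poly p (1 / \<epsilon>))"
  using distance_approximation_algorithm query_complexity_algorithm by blast

end
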